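(* Let $w=(a_1,\dots,a_{2n})$ be a word of length $2n$ in even integers. Then $h(w)=0$ if and only if $\mathrm{Conf}(w)=\varnothing$.
   Context: Fix $q\in\mathbb C^\times$ not a root of unity. $U=U_q\widehat{\mathfrak{sl}}_2$ (level zero) is the unital associative $\mathbb C$-algebra with generators $e_0,e_1,f_0,f_1,K^{\pm1}$ and relations $KK^{-1}=K^{-1}K=1$, $Ke_1K^{-1}=q^2e_1$, $Kf_1K^{-1}=q^{-2}f_1$, $Ke_0K^{-1}=q^{-2}e_0$, $Kf_0K^{-1}=q^{2}f_0$, $[e_1,f_1]=-[e_0,f_0]=\frac{K-K^{-1}}{q-q^{-1}}$, $[e_1,f_0]=[e_0,f_1]=0$, and for $i\neq j$ in $\{0,1\}$: $e_i^3e_j-(q^2+1+q^{-2})e_i^2e_je_i+(q^2+1+q^{-2})e_ie_je_i^2-e_je_i^3=0$ and the same relation with $e$ replaced by $f$. Tensor products of $U$-modules are formed with the coproduct $\Delta(K^{\pm1})=K^{\pm1}\otimes K^{\pm1}$, $\Delta(e_0)=e_0\otimes K^{-1}+1\otimes e_0$, $\Delta(f_0)=f_0\otimes 1+K\otimes f_0$, $\Delta(e_1)=e_1\otimes K+1\otimes e_1$, $\Delta(f_1)=f_1\otimes 1+K^{-1}\otimes f_1$. The trivial module $\mathbb C$ has $e_i,f_i$ acting by $0$ and $K$ by $1$. For $a\in 2\mathbb Z$ the two-dimensional evaluation module, denoted simply $a$, has basis $v_+,v_-$ with $Kv_\pm=q^{\pm1}v_\pm$, $e_1v_-=v_+$,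 $e_1v_+=0$, $f_1v_+=v_-$, $f_1v_-=0$, and $e_0,f_0$ acting as $q^{a}f_1$, $q^{-a}e_1$ respectively. A word $w=(a_1,\dots,a_k)$ of length $k$ is a sequence of even integers; it is also regarded as the $U$-module $a_1\otimes\cdots\otimes a_k$. Put $h(w)=\dim\mathrm{Hom}_U(\mathbb C,w)$. An arc in a word $w=(a_1,\dots,a_{2n})$ is a pair of positions $(i,j)$ with $1\le i<j\le 2n$ and $a_j=a_i+2$. An arc configuration of $w$ is a set of $n$ arcs $\{(i_1,j_1),\dots,(i_n,j_n)\}$ such that $\{1,\dots,2n\}$ is the disjoint union of the sets $\{i_k,j_k\}$. $\mathrm{Conf}(w)$ is the set of all arc configurations of $w$. *)

theory Defs
  imports Complex_Main "Jordan_Normal_Form.VS_Connect"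
begin

section \<open>The algebra $U_q\widehat{\mathfrak{sl}}_2$ at level zero\<close>

datatype uq_gen = E0 | E1 | F0 | F1 | Kp | Km

text \<open>
  Elements of the algebra are represented by expressions in the generators, where \<open>Kp\<close> and
  \<open>Km\<close> stand for $K$ and $K^{-1}$. The algebra itself is the set of expressions modulo the
  congruence \<open>uq_eq\<close> below. (It cannot be a quotient type, since it depends on \<open>q\<close>.)
\<close>

datatype uq_expr =
  Gen uq_gen | Scal complex | Plus uq_expr uq_expr | Times uq_expr uq_expr

instantiation uq_expr :: "{plus, minus, times, one}"
begin
definition "x + y = Plus x y"
definition "x - y = Plus x (Times (Scal (- 1)) y)"
definition "x * y = Times x y"
definition "1 = Scal 1"
instance ..
end

instance uq_expr :: power ..

definition commutator :: "uq_expr \<Rightarrow> uq_expr \<Rightarrow> uq_expr" where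
  "commutator x y = x * y - y * x"

definition serre :: "complex \<Rightarrow> uq_expr \<Rightarrow> uq_expr \<Rightarrow> uq_expr" where
  "serre q x y =
     x ^ 3 * y - Scal (q\<^sup>2 + 1 + 1 / q\<^sup>2) * x\<^sup>2 * y * x
     + Scal (q\<^sup>2 + 1 + 1 / q\<^sup>2) * x * y * x\<^sup>2 - y * x ^ 3"

definition uq_relations :: "complex \<Rightarrow> (uq_expr \<times> uq_expr) set" where
  "uq_relations q =
   {(Gen Kp * Gen Km, 1),
    (Gen Km * Gen Kp, 1),
    (Gen Kp * Gen E1 * Gen Km, Scal (q\<^sup>2) * Gen E1),
    (Gen Kp * Gen F1 * Gen Km, Scal (1 / q\<^sup>2) * Gen F1),
    (Gen Kp * Gen E0 * Gen Km, Scal (1 / q\<^sup>2) * Gen E0),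
    (Gen Kp * Gen F0 * Gen Km, Scal (q\<^sup>2) * Gen F0),
    (commutator (Gen E1) (Gen F1), Scal (1 / (q - 1 / q)) * (Gen Kp - Gen Km)),
    (commutator (Gen E0) (Gen F0), Scal (- 1 / (q - 1 / q)) * (Gen Kp - Gen Km)),
    (commutator (Gen E1) (Gen F0), Scal 0),
    (commutator (Gen E0) (Gen F1), Scal 0),
    (serre q (Gen E0) (Gen E1), Scal 0),
    (serre q (Gen E1) (Gen E0), Scal 0),
    (serre q (Gen F0) (Gen F1), Scal 0),
    (serre q (Gen F1) (Gen F0), Scal 0)}"

text \<open>
  The least congruence containing the relations and making the expressions a unital
  associative algebra over the complex numbers.
\<close>

inductive uq_eq :: "complex \<Rightarrow> uq_expr \<Rightarrow> uq_expr \<Rightarrow> bool" for q where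
  rel: "(x, y) \<in> uq_relations q \<Longrightarrow> uq_eq q x y"
| refl: "uq_eq q x x"
| sym: "uq_eq q x y \<Longrightarrow> uq_eq q y x"
| trans: "uq_eq q x y \<Longrightarrow> uq_eq q y z \<Longrightarrow> uq_eq q x z"
| plus_cong: "uq_eq q x x' \<Longrightarrow> uq_eq q y y' \<Longrightarrow> uq_eq q (x + y) (x' + y')"
| times_cong: "uq_eq q x x' \<Longrightarrow> uq_eq q y y' \<Longrightarrow> uq_eq q (x * y) (x' * y')"
| plus_assoc: "uq_eq q (x + y + z) (x + (y + z))"
| plus_comm: "uq_eq q (x + y) (y + x)"
| plus_zero: "uq_eq q (x + Scal 0) x"
| plus_neg: "uq_eq q (x - x) (Scal 0)"
| times_assoc: "uq_eq q (x * y * z) (x * (y * z))"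
| times_one_left: "uq_eq q (1 * x) x"
| times_one_right: "uq_eq q (x * 1) x"
| distrib_right: "uq_eq q ((x + y) * z) (x * z + y * z)"
| distrib_left: "uq_eq q (x * (y + z)) (x * y + x * z)"
| scal_plus: "uq_eq q (Scal a + Scal b) (Scal (a + b))"
| scal_times: "uq_eq q (Scal a * Scal b) (Scal (a * b))"
| scal_central: "uq_eq q (Scal a * x) (x * Scal a)"

section \<open>Finite-dimensional modules\<close>

text \<open>
  A finite-dimensional module with a chosen ordered basis is given by its dimension and by the
  matrices of the generators. Matrices act on column vectors.
\<close>

record uq_mod =
  mdim :: nat
  gact :: "uq_gen \<Rightarrow> complex mat"

fun act :: "uq_mod \<Rightarrow> uq_expr \<Rightarrow> complex mat" where
  "act M (Gen g) = gact M g"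
| "act M (Scal c) = c \<cdot>\<^sub>m 1\<^sub>m (mdim M)"
| "act M (Plus x y) = act M x + act M y"
| "act M (Times x y) = act M x * act M y"

definition is_uq_module :: "complex \<Rightarrow> uq_mod \<Rightarrow> bool" where
  "is_uq_module q M \<longleftrightarrow>
     (\<forall>g. gact M g \<in> carrier_mat (mdim M) (mdim M)) \<and>
     (\<forall>x y. uq_eq q x y \<longrightarrow> act M x = act M y)"

text \<open>
  The Kronecker product: the matrix of a tensor product of linear maps with respect to the
  lexicographically ordered product bases.
\<close>

definition kron :: "complex mat \<Rightarrow> complex mat \<Rightarrow> complex mat" where
  "kron A B = mat (dim_row A * dim_row B) (dim_col A * dim_col B)
     (\<lambda>(i, j). A $$ (i div dim_row B, j div dim_col B) * B $$ (i mod dim_row B, j mod dim_col B))"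

definition tensor_mod :: "uq_mod \<Rightarrow> uq_mod \<Rightarrow> uq_mod" where
  "tensor_mod M N =
    \<lparr>mdim = mdim M * mdim N,
     gact = (\<lambda>g. case g of
         Kp \<Rightarrow> kron (gact M Kp) (gact N Kp)
       | Km \<Rightarrow> kron (gact M Km) (gact N Km)
       | E0 \<Rightarrow> kron (gact M E0) (gact N Km) + kron (1\<^sub>m (mdim M)) (gact N E0)
       | F0 \<Rightarrow> kron (gact M F0) (1\<^sub>m (mdim N)) + kron (gact M Kp) (gact N F0)
       | E1 \<Rightarrow> kron (gact M E1) (gact N Kp) + kron (1\<^sub>m (mdim M)) (gact N E1)
       | F1 \<Rightarrow> kron (gact M F1) (1\<^sub>m (mdim N)) + kron (gact M Km) (gact N F1))\<rparr>"

definition trivial_mod :: uq_mod where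
  "trivial_mod =
    \<lparr>mdim = 1,
     gact = (\<lambda>g. if g \<in> {Kp, Km} then 1\<^sub>m 1 else 0\<^sub>m 1 1)\<rparr>"

text \<open>The ordered basis of the evaluation module is $v_+, v_-$.\<close>

definition eval_mod :: "complex \<Rightarrow> int \<Rightarrow> uq_mod" where
  "eval_mod q a =
    (let e = mat_of_rows_list 2 [[0, 1], [0, 0]];
         f = mat_of_rows_list 2 [[0, 0], [1, 0]]
     in \<lparr>mdim = 2,
         gact = (\<lambda>g. case g of
             Kp \<Rightarrow> mat_of_rows_list 2 [[q, 0], [0, 1 / q]]
           | Km \<Rightarrow> mat_of_rows_list 2 [[1 / q, 0], [0, q]]
           | E1 \<Rightarrow> e
           | F1 \<Rightarrow> f
           | E0 \<Rightarrow> (q powi a) \<cdot>\<^sub>m f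
           | F0 \<Rightarrow> (q powi (- a)) \<cdot>\<^sub>m e)\<rparr>)"

definition word_mod :: "complex \<Rightarrow> int list \<Rightarrow> uq_mod" where
  "word_mod q w = foldr (\<lambda>a M. tensor_mod (eval_mod q a) M) w trivial_mod"

definition uq_hom :: "uq_mod \<Rightarrow> uq_mod \<Rightarrow> complex mat set" where
  "uq_hom M N = {T \<in> carrier_mat (mdim N) (mdim M). \<forall>x. T * act M x = act N x * T}"

definition uq_hom_space :: "uq_mod \<Rightarrow> uq_mod \<Rightarrow> (complex, complex mat) module" where
  "uq_hom_space M N = (module_mat TYPE(complex) (mdim N) (mdim M))\<lparr>carrier := uq_hom M N\<rparr>"

definition hdim :: "complex \<Rightarrow> int list \<Rightarrow> nat" where
  "hdim q w = vectorspace.dim class_ring (uq_hom_space trivial_mod (word_mod q w))"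

section \<open>Arc configurations\<close>

text \<open>Positions in a word are counted from 0.\<close>

definition arcs :: "int list \<Rightarrow> (nat \<times> nat) set" where
  "arcs w = {(i, j). i < j \<and> j < length w \<and> w ! j = w ! i + 2}"

definition Conf :: "int list \<Rightarrow> (nat \<times> nat) set set" where
  "Conf w = {C. C \<subseteq> arcs w \<and> 2 * card C = length w \<and>
     disjoint_family_on (\<lambda>(i, j). {i, j}) C \<and> (\<Union>(i, j)\<in>C. {i, j}) = {..<length w}}"

section \<open>Well-definedness\<close>

lemmas uq_expr_defs =
  plus_uq_expr_def minus_uq_expr_def times_uq_expr_def one_uq_expr_def

lemma act_simps [simp]:
  "act M (x + y) = act M x + act M y"
  "act M (x * y) = act M x * act M y"
  "act M 1 = 1\<^sub>m (mdim M)"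
  by (auto simp: uq_expr_defs)

lemma act_carrier:
  assumes "\<And>g. gact M g \<in> carrier_mat (mdim M) (mdim M)"
  shows "act M x \<in> carrier_mat (mdim M) (mdim M)"
  by (induction x) (use assms in auto)

lemma act_minus:
  assumes g: "\<And>g. gact M g \<in> carrier_mat (mdim M) (mdim M)"
  shows "act M (x - y) = act M x - act M y"
  using act_carrier[of M x, OF g] act_carrier[of M y, OF g]
  by (auto simp: uq_expr_defs smult_carrier_mat)

lemma is_uq_moduleI:
  assumes g: "\<And>g. gact M g \<in> carrier_mat (mdim M) (mdim M)"
    and r: "\<And>x y. (x, y) \<in> uq_relations q \<Longrightarrow> act M x = act M y"
  shows "is_uq_module q M"
proof -
  note c = act_carrier[of M, OF g]
  have "act M x = act M y" if "uq_eq q x y" for x y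
    using that
  proof induction
    case (times_assoc x y z)
    then show ?case using assoc_mult_mat[OF c c c] by simp
  next
    case (distrib_right x y z)
    then show ?case using add_mult_distrib_mat[OF c c c] by simp
  next
    case (distrib_left x y z)
    then show ?case using mult_add_distrib_mat[OF c c c] by simp
  next
    case (plus_assoc x y z)
    then show ?case using assoc_add_mat[OF c c c] by simp
  next
    case (plus_comm x y)
    then show ?case using comm_add_mat[OF c c] by simp
  next
    case (plus_zero x)
    then show ?case using c[of x] by auto
  next
    case (plus_neg x)
    then show ?case using c[of x] by (auto simp: act_minus[OF g])
  next
    case (times_one_left x)
    then show ?case using c[of x] by simp
  next
    case (times_one_right x)
    then show ?case using c[of x] by simp
  next
    case (scal_plus a b)
    then show ?case by (auto simp: distrib_right)
  next
    case (scal_times a b)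
    then show ?case by (auto simp: mult_smult_distrib[of _ _ "mdim M"])
  next
    case (scal_central a x)
    then show ?case
      using c[of x] mult_smult_distrib[OF c[of x], of "1\<^sub>m (mdim M)" "mdim M" a]
        mult_smult_assoc_mat[of "1\<^sub>m (mdim M)" "mdim M" "mdim M", OF _ c[of x], of a]
      by simp
  qed (use r in auto)
  with g show ?thesis by (auto simp: is_uq_module_def)
qed

lemma trivial_mod_is_uq_module: "is_uq_module q trivial_mod"
  by (rule is_uq_moduleI)
     (auto simp: trivial_mod_def uq_relations_def commutator_def serre_def uq_expr_defs
        scalar_prod_def numeral_eq_Suc intro!: eq_matI)

lemma eval_mod_is_uq_module:
  assumes "q \<noteq> 0" "q\<^sup>2 \<noteq> 1"
  shows "is_uq_module q (eval_mod q a)"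
proof (rule is_uq_moduleI)
  show "gact (eval_mod q a) g \<in> carrier_mat (mdim (eval_mod q a)) (mdim (eval_mod q a))" for g
    by (cases g) (auto simp: eval_mod_def mat_of_rows_list_def Let_def)
next
  fix x y
  assume xy: "(x, y) \<in> uq_relations q"
  have "q - 1 / q \<noteq> 0"
    using assms by (simp add: divide_simps power2_eq_square)
  then show "act (eval_mod q a) x = act (eval_mod q a) y"
    using xy assms
    by (auto simp: eval_mod_def mat_of_rows_list_def Let_def uq_relations_def commutator_def serre_def
        uq_expr_defs scalar_prod_def numeral_eq_Suc less_Suc_eq power_int_minus
        divide_simps power2_eq_square intro!: eq_matI)
qed

lemma uq_hom_space_vectorspace:
  assumes "\<And>g. gact M g \<in> carrier_mat (mdim M) (mdim M)"
    and "\<And>g. gact N g \<in> carrier_mat (mdim N) (mdim N)"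
  shows "vectorspace class_ring (uq_hom_space M N)"
proof -
  interpret matrix_vs "mdim N" "mdim M" "TYPE(complex)" .
  note c = act_carrier[of M, OF assms(1)] and d = act_carrier[of N, OF assms(2)]
  have "VectorSpace.subspace class_ring (uq_hom M N) V"
  proof (rule VectorSpace.subspace.intro[OF matrix_vs], rule submodule.intro)
    show "Module.module class_ring V"
      using matrix_vs by (rule vectorspace.axioms)
  next
    fix v w assume v: "v \<in> uq_hom M N" and w: "w \<in> uq_hom M N"
    then have *: "v \<in> carrier_mat (mdim N) (mdim M)" "w \<in> carrier_mat (mdim N) (mdim M)"
      by (auto simp: uq_hom_def)
    have "(v + w) * act M x = act N x * (v + w)" for x
      using v w add_mult_distrib_mat[OF * c] mult_add_distrib_mat[OF d *]
      by (simp add: uq_hom_def)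
    with * show "v \<oplus>\<^bsub>V\<^esub> w \<in> uq_hom M N"
      by (simp add: uq_hom_def matrix_vs_simps)
  next
    have "0\<^sub>m (mdim N) (mdim M) * act M x = act N x * 0\<^sub>m (mdim N) (mdim M)" for x
      using left_mult_zero_mat[OF c] right_mult_zero_mat[OF d] by simp
    then show "\<zero>\<^bsub>V\<^esub> \<in> uq_hom M N"
      by (simp add: uq_hom_def matrix_vs_simps)
  next
    fix k :: complex and v assume v: "v \<in> uq_hom M N"
    then have *: "v \<in> carrier_mat (mdim N) (mdim M)"
      by (simp add: uq_hom_def)
    have "(k \<cdot>\<^sub>m v) * act M x = act N x * (k \<cdot>\<^sub>m v)" for x
      using v mult_smult_assoc_mat[OF * c] mult_smult_distrib[OF d *]
      by (simp add: uq_hom_def)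
    with * show "k \<odot>\<^bsub>V\<^esub> v \<in> uq_hom M N"
      by (simp add: uq_hom_def matrix_vs_simps)
  qed (auto simp: uq_hom_def matrix_vs_simps)
  then show ?thesis
    unfolding uq_hom_space_def
    by (rule vectorspace.subspace_is_vs[OF matrix_vs])
qed

lemma tensor_mod_carrier:
  assumes "\<And>g. gact M g \<in> carrier_mat (mdim M) (mdim M)"
    and "\<And>g. gact N g \<in> carrier_mat (mdim N) (mdim N)"
  shows "gact (tensor_mod M N) g \<in> carrier_mat (mdim (tensor_mod M N)) (mdim (tensor_mod M N))"
  using assms[THEN carrier_matD(1)] assms[THEN carrier_matD(2)]
  by (cases g) (auto simp: tensor_mod_def kron_def)

lemma word_mod_carrier:
  "gact (word_mod q w) g \<in> carrier_mat (mdim (word_mod q w)) (mdim (word_mod q w))"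
proof (induction w arbitrary: g)
  case Nil
  then show ?case by (simp add: word_mod_def trivial_mod_def)
next
  case (Cons a w)
  have "gact (eval_mod q a) g \<in> carrier_mat (mdim (eval_mod q a)) (mdim (eval_mod q a))" for g
    by (cases g) (auto simp: eval_mod_def mat_of_rows_list_def Let_def)
  from tensor_mod_carrier[OF this Cons.IH] show ?case
    by (simp add: word_mod_def)
qed

lemma hdim_vectorspace: "vectorspace class_ring (uq_hom_space trivial_mod (word_mod q w))"
  by (rule uq_hom_space_vectorspace)
     (simp add: trivial_mod_def, rule word_mod_carrier)

lemma kron_one_right [simp]: "kron A (1\<^sub>m (Suc 0)) = A"
  by (auto simp: kron_def intro!: eq_matI)

lemma kron_zero_right [simp]: "kron A (0\<^sub>m (Suc 0) (Suc 0)) = 0\<^sub>m (dim_row A) (dim_col A)"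
  by (auto simp: kron_def intro!: eq_matI)

lemma word_mod_singleton: "word_mod q [a] = eval_mod q a"
  by (auto simp: word_mod_def tensor_mod_def trivial_mod_def eval_mod_def mat_of_rows_list_def
      Let_def fun_eq_iff numeral_2_eq_2 split: uq_gen.splits)

end

theory Submission
  imports Defs "Jordan_Normal_Form.Spectral_Radius" "HOL-Combinatorics.Transposition"
begin

text \<open>
  If the word has a configuration, an invariant is built by inserting one arc $(a, a + 2)$ at a time:
  the module $a \otimes (a + 2)$ has an invariant vector, and for generic parameters the end of the arc
  can be moved to its place by invertible R-matrices. As the parameters specialise, the normalised
  invariant vectors have a limit point, which is again a nonzero invariant.

  Conversely let the word have a nonzero invariant, and let $M$ be its largest letter. Move $M$ to
  the left by R-matrices $a \otimes M \to M \otimes a$. These are injective unless $a = M - 2$, when the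
  kernel consists of the invariants of $a \otimes M$. If the invariant is killed, it comes from an
  invariant of the word without $a$ and $M$, which has a configuration by induction, and $(a, M)$ is
  added to it. If it survives, the swapped word has a configuration by induction, hence so does the
  original one. Finally $M$ cannot come first, since no arc could start there.
\<close>

section \<open>Tensor products in coordinates\<close>

text \<open>
  A vector of $z_1 \otimes \dots \otimes z_n$ is given by its coordinates: the list of booleans names
  a product of basis vectors, with \<open>True\<close> for $v_+$ and \<open>False\<close> for $v_-$. Only lists of length $n$
  are meaningful. The spectral parameters $z_i$ are arbitrary nonzero complex numbers, so that
  they can be deformed.
\<close>

type_synonym tensor = "bool list \<Rightarrow> complex"

text \<open>The counit: the scalars by which the generators act on the trivial module.\<close>

definition eps :: "uq_gen \<Rightarrow> complex" where
  "eps g = (if g \<in> {Kp, Km} then 1 else 0)"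

text \<open>Iterated coproduct with the leftmost factor split off at each step. Its matrix entries
  on the basis v_+, v_- are already substituted, so each clause lists only the summands that
  contribute to the given first letter.\<close>

fun uop :: "complex \<Rightarrow> uq_gen \<Rightarrow> complex list \<Rightarrow> tensor \<Rightarrow> tensor" where
  "uop q g [] \<psi> l = (if l = [] then eps g * \<psi> [] else 0)"
| "uop q g (z # zs) \<psi> [] = 0"
| "uop q g (z # zs) \<psi> (True # l) = (case g of
      Kp \<Rightarrow> q * uop q Kp zs (\<lambda>l. \<psi> (True # l)) l
    | Km \<Rightarrow> 1 / q * uop q Km zs (\<lambda>l. \<psi> (True # l)) l
    | E0 \<Rightarrow> uop q E0 zs (\<lambda>l. \<psi> (True # l)) l
    | F0 \<Rightarrow> 1 / z * \<psi> (False # l) + q * uop q F0 zs (\<lambda>l. \<psi> (True # l)) l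
    | E1 \<Rightarrow> uop q Kp zs (\<lambda>l. \<psi> (False # l)) l + uop q E1 zs (\<lambda>l. \<psi> (True # l)) l
    | F1 \<Rightarrow> 1 / q * uop q F1 zs (\<lambda>l. \<psi> (True # l)) l)"
| "uop q g (z # zs) \<psi> (False # l) = (case g of
      Kp \<Rightarrow> 1 / q * uop q Kp zs (\<lambda>l. \<psi> (False # l)) l
    | Km \<Rightarrow> q * uop q Km zs (\<lambda>l. \<psi> (False # l)) l
    | E0 \<Rightarrow> z * uop q Km zs (\<lambda>l. \<psi> (True # l)) l + uop q E0 zs (\<lambda>l. \<psi> (False # l)) l
    | F0 \<Rightarrow> 1 / q * uop q F0 zs (\<lambda>l. \<psi> (False # l)) l
    | E1 \<Rightarrow> uop q E1 zs (\<lambda>l. \<psi> (False # l)) l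
    | F1 \<Rightarrow> \<psi> (True # l) + q * uop q F1 zs (\<lambda>l. \<psi> (False # l)) l)"

definition inv_tensor :: "complex \<Rightarrow> complex list \<Rightarrow> tensor \<Rightarrow> bool" where
  "inv_tensor q zs \<psi> \<longleftrightarrow> (\<forall>g l. uop q g zs \<psi> l = eps g * \<psi> l)"

definition has_inv :: "complex \<Rightarrow> complex list \<Rightarrow> bool" where
  "has_inv q zs \<longleftrightarrow> (\<exists>\<psi>. inv_tensor q zs \<psi> \<and> \<psi> \<noteq> (\<lambda>l. 0))"

lemma uop_add: "uop q g zs (\<lambda>l. \<psi> l + \<phi> l) l = uop q g zs \<psi> l + uop q g zs \<phi> l"
proof (induction zs arbitrary: g \<psi> \<phi> l)
  case (Cons z zs)
  then show ?case
    by (cases "(q, g, z # zs, \<psi>, l)" rule: uop.cases)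
      (auto split: uq_gen.split simp: algebra_simps add_divide_distrib)
qed (simp add: algebra_simps)

lemma uop_scale: "uop q g zs (\<lambda>l. c * \<psi> l) l = c * uop q g zs \<psi> l"
  by (induction q g zs \<psi> l rule: uop.induct)
    (auto split: uq_gen.split simp: algebra_simps)

lemma uop_zero [simp]: "uop q g zs (\<lambda>l. 0) l = 0"
  using uop_scale[of q g zs 0 "\<lambda>l. 0" l] by simp

text \<open>The summands coming from \<open>F0\<close> and \<open>F1\<close> acting on the first
  factor read \<open>\<psi>\<close> without further recursion, so junk at lists of wrong length has
  to be excluded by assumption.\<close>

lemma uop_support:
  assumes "\<And>l. length l \<noteq> length zs \<Longrightarrow> \<psi> l = 0" "length l \<noteq> length zs"
  shows "uop q g zs \<psi> l = 0"
  using assms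
  by (induction q g zs \<psi> l rule: uop.induct) (auto split: uq_gen.split)

text \<open>Invariance under \<open>Kp\<close> alone suffices: K only multiplies coordinates by
  scalars letter by letter, the recursion ends in 0 at a list of wrong length, and
  \<open>eps Kp = 1\<close>.\<close>

lemma inv_tensor_support:
  assumes "inv_tensor q zs \<psi>" "length l \<noteq> length zs"
  shows "\<psi> l = 0"
proof -
  have "uop q Kp zs \<psi> l = 0" for \<psi>
    using assms(2)
  proof (induction zs arbitrary: \<psi> l)
    case (Cons z zs)
    then show ?case by (cases "(q, Kp, z # zs, \<psi>, l)" rule: uop.cases) auto
  qed auto
  then show ?thesis
    using assms(1)[unfolded inv_tensor_def, rule_format, of Kp l] by (simp add: eps_def)
qed

section \<open>Intertwiners, their kernels, and extension by identity factors\<close>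

definition intertwiner ::
  "complex \<Rightarrow> complex list \<Rightarrow> complex list \<Rightarrow> (tensor \<Rightarrow> tensor) \<Rightarrow> bool" where
  "intertwiner q zs zs' T \<longleftrightarrow>
     (\<forall>\<psi> \<phi>. T (\<lambda>l. \<psi> l + \<phi> l) = (\<lambda>l. T \<psi> l + T \<phi> l)) \<and>
     (\<forall>c \<psi>. T (\<lambda>l. c * \<psi> l) = (\<lambda>l. c * T \<psi> l)) \<and>
     (\<forall>g \<psi>. uop q g zs' (T \<psi>) = T (uop q g zs \<psi>))"

text \<open>The map $\mathrm{id} \otimes T$ on a product with one more factor on the left.\<close>

fun lift1 :: "(tensor \<Rightarrow> tensor) \<Rightarrow> tensor \<Rightarrow> tensor" where
  "lift1 T \<psi> [] = \<psi> []"
| "lift1 T \<psi> (b # l) = T (\<lambda>l. \<psi> (b # l)) l"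

text \<open>The action on the longer product combines linearly the slices with fixed first letter
  and their images under generators. A linear map that commutes with the generators passes through
  both.\<close>

lemma intertwiner_lift1:
  assumes "intertwiner q zs zs' T"
  shows "intertwiner q (z # zs) (z # zs') (lift1 T)"
proof -
  have add: "T (\<lambda>l. \<psi> l + \<phi> l) = (\<lambda>l. T \<psi> l + T \<phi> l)"
    and scale: "T (\<lambda>l. c * \<psi> l) = (\<lambda>l. c * T \<psi> l)"
    and comm: "uop q g zs' (T \<psi>) = T (uop q g zs \<psi>)" for \<psi> \<phi> c g
    using assms by (auto simp: intertwiner_def)
  have "uop q g (z # zs') (lift1 T \<psi>) l = lift1 T (uop q g (z # zs) \<psi>) l" for g \<psi> l
  proof (cases l)
    case (Cons b l')
    then show ?thesis
      by (cases b; cases g) (simp_all only: uop.simps lift1.simps uq_gen.case add scale comm)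
  qed simp
  moreover have "lift1 T (\<lambda>l. \<psi> l + \<phi> l) l = lift1 T \<psi> l + lift1 T \<phi> l" for \<psi> \<phi> l
    by (cases l) (auto simp: add)
  moreover have "lift1 T (\<lambda>l. c * \<psi> l) l = c * lift1 T \<psi> l" for c \<psi> l
    by (cases l) (auto simp: scale)
  ultimately show ?thesis
    by (auto simp: intertwiner_def)
qed

lemma intertwiner_lift:
  assumes "intertwiner q zs zs' T"
  shows "intertwiner q (us @ zs) (us @ zs') ((lift1 ^^ length us) T)"
  using assms by (induction us) (auto intro: intertwiner_lift1)

lemma has_inv_intertwiner:
  assumes "intertwiner q zs zs' T" "inv_tensor q zs \<psi>" "T \<psi> \<noteq> (\<lambda>l. 0)"
  shows "has_inv q zs'"
proof -
  have "uop q g zs \<psi> = (\<lambda>l. eps g * \<psi> l)" for g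
    using assms(2) by (auto simp: inv_tensor_def)
  with assms(1) have "uop q g zs' (T \<psi>) = (\<lambda>l. eps g * T \<psi> l)" for g
    by (simp add: intertwiner_def)
  with assms(3) show ?thesis
    unfolding has_inv_def inv_tensor_def by (intro exI[of _ "T \<psi>"]) auto
qed

text \<open>Tensors with values at lists shorter than \<open>m\<close> are excluded because a map on
  the first \<open>m\<close> factors, such as \<open>rmat\<close> with \<open>m = 2\<close>, cannot
  detect those values.\<close>

definition ker_within :: "nat \<Rightarrow> (tensor \<Rightarrow> tensor) \<Rightarrow> tensor set \<Rightarrow> bool" where
  "ker_within m T S \<longleftrightarrow>
     (\<forall>\<psi>. (\<forall>l. length l < m \<longrightarrow> \<psi> l = 0) \<longrightarrow> T \<psi> = (\<lambda>l. 0) \<longrightarrow> \<psi> \<in> S)"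

text \<open>Exactness survives an identity factor on the left: both slices of a kernel element lie
  in the kernel of \<open>T\<close>, and their preimages under \<open>J\<close> can be
  glued.\<close>

lemma ker_within_lift1:
  assumes "ker_within m T (range J)"
  shows "ker_within (Suc m) (lift1 T) (range (lift1 J))"
  unfolding ker_within_def
proof (intro allI impI)
  fix \<psi> :: tensor
  assume 0: "\<forall>l. length l < Suc m \<longrightarrow> \<psi> l = 0" and T: "lift1 T \<psi> = (\<lambda>l. 0)"
  have "(\<lambda>l. \<psi> (b # l)) \<in> range J" for b
  proof -
    have "T (\<lambda>l. \<psi> (b # l)) = (\<lambda>l. 0)"
      using fun_cong[OF T, of "b # _"] by auto
    with 0 assms show ?thesis by (simp add: ker_within_def)
  qed
  then have "\<exists>\<phi>. (\<lambda>l. \<psi> (b # l)) = J \<phi>" for b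
    by blast
  then obtain \<phi> where \<phi>: "\<And>b. (\<lambda>l. \<psi> (b # l)) = J (\<phi> b)"
    by metis
  \<comment> \<open>The value 0 of the glued preimage at the empty list agrees with
    \<open>\<psi> []\<close>, since \<open>lift1\<close> leaves that coordinate alone.\<close>
  have "\<psi> l = lift1 J (\<lambda>l. case l of [] \<Rightarrow> 0 | b # l' \<Rightarrow> \<phi> b l') l" for l
    using 0 fun_cong[OF \<phi>] by (cases l) auto
  then show "\<psi> \<in> range (lift1 J)"
    by blast
qed

lemma ker_within_lift:
  assumes "ker_within m T (range J)"
  shows "ker_within (k + m) ((lift1 ^^ k) T) (range ((lift1 ^^ k) J))"
  using assms by (induction k) (auto intro: ker_within_lift1)

lemma inj_lift1:
  assumes "inj J"
  shows "inj (lift1 J)"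
proof (rule injI)
  fix \<psi> \<phi> assume eq: "lift1 J \<psi> = lift1 J \<phi>"
  have "J (\<lambda>l. \<psi> (b # l)) = J (\<lambda>l. \<phi> (b # l))" for b
    using fun_cong[OF eq, of "b # _"] by auto
  then have "(\<lambda>l. \<psi> (b # l)) = (\<lambda>l. \<phi> (b # l))" for b
    using assms by (auto dest: injD)
  then have "\<psi> (b # l) = \<phi> (b # l)" for b l
    by meson
  moreover have "\<psi> [] = \<phi> []"
    using fun_cong[OF eq, of "[]"] by simp
  ultimately show "\<psi> = \<phi>"
    by (metis ext neq_Nil_conv)
qed

lemma inj_lift: "inj J \<Longrightarrow> inj ((lift1 ^^ k) J)"
  by (induction k) (auto intro: inj_lift1)

lemma inv_tensor_reflect:
  assumes "intertwiner q zs zs' J" "inj J" "inv_tensor q zs' (J \<psi>)"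
  shows "inv_tensor q zs \<psi>"
proof -
  have "J (uop q g zs \<psi>) = J (\<lambda>l. eps g * \<psi> l)" for g
    using assms(1,3) by (auto simp: intertwiner_def inv_tensor_def fun_eq_iff)
  then have "uop q g zs \<psi> = (\<lambda>l. eps g * \<psi> l)" for g
    using assms(2) by (auto dest: injD)
  then show ?thesis
    by (simp add: inv_tensor_def)
qed

section \<open>R-matrices and the invariant of a single arc\<close>

text \<open>
  The R-matrix $a \otimes b \to b \otimes a$, scaled so that it is polynomial in the parameters. On the
  weight zero space its determinant is $-(q^2 b - a)(b - q^2 a)$. Hence for $a \neq q^2 b$ it is
  injective unless $b = q^2 a$, and then its kernel is the line of invariants, spanned by \<open>cup\<close>.
\<close>

fun rmat :: "complex \<Rightarrow> complex \<Rightarrow> complex \<Rightarrow> tensor \<Rightarrow> tensor" where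
  "rmat q a b \<psi> (True # True # l) = (q\<^sup>2 * b - a) * \<psi> (True # True # l)"
| "rmat q a b \<psi> (True # False # l) =
     a * (q\<^sup>2 - 1) * \<psi> (True # False # l) + q * (b - a) * \<psi> (False # True # l)"
| "rmat q a b \<psi> (False # True # l) =
     q * (b - a) * \<psi> (True # False # l) + b * (q\<^sup>2 - 1) * \<psi> (False # True # l)"
| "rmat q a b \<psi> (False # False # l) = (q\<^sup>2 * b - a) * \<psi> (False # False # l)"
| "rmat q a b \<psi> _ = 0"

fun cup :: "complex \<Rightarrow> tensor \<Rightarrow> tensor" where
  "cup q \<phi> (True # True # l) = 0"
| "cup q \<phi> (True # False # l) = q * \<phi> l"
| "cup q \<phi> (False # True # l) = - \<phi> l"
| "cup q \<phi> (False # False # l) = 0"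
| "cup q \<phi> _ = 0"

lemma rmat_scale: "rmat q a b (\<lambda>l. c * \<psi> l) l = c * rmat q a b \<psi> l"
  by (induction q a b \<psi> l rule: rmat.induct) (auto simp: algebra_simps)

lemma rmat_add: "rmat q a b (\<lambda>l. \<psi> l + \<phi> l) l = rmat q a b \<psi> l + rmat q a b \<phi> l"
  by (induction q a b \<psi> l rule: rmat.induct) (auto simp: algebra_simps)

lemma cup_scale: "cup q (\<lambda>l. c * \<psi> l) l = c * cup q \<psi> l"
  by (induction q \<psi> l rule: cup.induct) (auto simp: algebra_simps)

lemma cup_add: "cup q (\<lambda>l. \<psi> l + \<phi> l) l = cup q \<psi> l + cup q \<phi> l"
  by (induction q \<psi> l rule: cup.induct) (auto simp: algebra_simps)

lemma intertwiner_rmat: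
  assumes "q \<noteq> 0" "a \<noteq> 0" "b \<noteq> 0"
  shows "intertwiner q (a # b # zs) (b # a # zs) (rmat q a b)"
proof -
  have "uop q g (b # a # zs) (rmat q a b \<psi>) (s # t # l)
      = rmat q a b (uop q g (a # b # zs) \<psi>) (s # t # l)" for g \<psi> s t l
    by (cases g; cases s; cases t; simp add: uop_add uop_scale;
        use assms in \<open>simp add: field_simps power2_eq_square\<close>)
  moreover have "uop q g (b # a # zs) (rmat q a b \<psi>) [s] = 0" for g \<psi> s
    by (cases s) (auto split: uq_gen.split)
  \<comment> \<open>\<open>remdups_adj.cases\<close> serves only as a split of lists into length 0,
    length 1 and at least two letters; the equation is demanded at short lists too, where both sides
    vanish.\<close>
  ultimately have "uop q g (b # a # zs) (rmat q a b \<psi>) l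
      = rmat q a b (uop q g (a # b # zs) \<psi>) l" for g \<psi> l
    by (cases l rule: remdups_adj.cases) (simp_all del: uop.simps(3,4) rmat.simps(1-4))
  then show ?thesis
    by (auto simp: intertwiner_def rmat_add rmat_scale)
qed

text \<open>The inserted vector is q v_+ v_- - v_- v_+. It is killed by \<open>E1\<close> for all
  parameters, while \<open>E0\<close> sends it to q^2 a - b times v_- v_-, where a and b are the two
  parameters. This forces b = q^2 a, the shift by 2 in the definition of an arc.\<close>

lemma intertwiner_cup:
  assumes "q \<noteq> 0" "a \<noteq> 0"
  shows "intertwiner q zs (a # (q\<^sup>2 * a) # zs) (cup q)"
proof -
  have m: "uop q g zs (\<lambda>l. - \<psi> l) l = - uop q g zs \<psi> l" for g \<psi> l
    using uop_scale[of q g zs "-1" \<psi> l] by simp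
  have "uop q g (a # (q\<^sup>2 * a) # zs) (cup q \<psi>) (s # t # l)
      = cup q (uop q g zs \<psi>) (s # t # l)" for g \<psi> s t l
    by (cases g; cases s; cases t; simp add: uop_scale m;
        use assms in \<open>simp add: field_simps power2_eq_square\<close>)
  moreover have "uop q g (a # (q\<^sup>2 * a) # zs) (cup q \<psi>) [s] = 0" for g \<psi> s
    by (cases s) (auto split: uq_gen.split)
  ultimately have "uop q g (a # (q\<^sup>2 * a) # zs) (cup q \<psi>) l = cup q (uop q g zs \<psi>) l" for g \<psi> l
    by (cases l rule: remdups_adj.cases) (simp_all del: uop.simps(3,4) cup.simps(1-4))
  then show ?thesis
    by (auto simp: intertwiner_def cup_add cup_scale)
qed

lemma ker_within_rmat:
  assumes "q \<noteq> 0" "q\<^sup>2 \<noteq> 1" "a \<noteq> q\<^sup>2 * b" "a \<noteq> 0" "b \<noteq> 0"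
  shows "ker_within 2 (rmat q a b) (range (\<lambda>\<phi> l. if b = q\<^sup>2 * a then cup q \<phi> l else 0))"
  unfolding ker_within_def
proof (intro allI impI)
  fix \<psi> :: tensor
  assume 0: "\<forall>l. length l < 2 \<longrightarrow> \<psi> l = 0" and R: "rmat q a b \<psi> = (\<lambda>l. 0)"
  have pp: "\<psi> (True # True # l) = 0" "\<psi> (False # False # l) = 0" for l
    using fun_cong[OF R, of "True # True # l"] fun_cong[OF R, of "False # False # l"] assms by auto
  have e1: "a * (q\<^sup>2 - 1) * \<psi> (True # False # l) + q * (b - a) * \<psi> (False # True # l) = 0"
    and e2: "q * (b - a) * \<psi> (True # False # l) + b * (q\<^sup>2 - 1) * \<psi> (False # True # l) = 0" for l
    using fun_cong[OF R, of "True # False # l"] fun_cong[OF R, of "False # True # l"] by auto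
  show "\<psi> \<in> range (\<lambda>\<phi> l. if b = q\<^sup>2 * a then cup q \<phi> l else 0)"
  proof (cases "b = q\<^sup>2 * a")
    case True
    have "\<psi> (True # False # l) = - q * \<psi> (False # True # l)" for l
    proof -
      \<comment> \<open>At \<open>b = q\<^sup>2 * a\<close> the two weight zero equations are
        proportional, so one of them already determines the line.\<close>
      have "a * (q\<^sup>2 - 1) * (\<psi> (True # False # l) + q * \<psi> (False # True # l)) = 0"
        using e1[of l] True by (simp add: algebra_simps)
      then show ?thesis using assms by (simp add: eq_neg_iff_add_eq_0)
    qed
    \<comment> \<open>The preimage is read off at \<open>False # True # l\<close>, where
      \<open>cup\<close> has coefficient -1.\<close>
    then have "\<psi> l = cup q (\<lambda>l. - \<psi> (False # True # l)) l" for l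
      using 0 pp by (cases "(q, \<psi>, l)" rule: cup.cases) auto
    with True show ?thesis by auto
  next
    case False
    have det: "(q\<^sup>2 * b - a) * (b - q\<^sup>2 * a) = (q * (b - a))\<^sup>2 - a * (q\<^sup>2 - 1) * (b * (q\<^sup>2 - 1))"
      by (simp add: algebra_simps power2_eq_square)
    have "(q\<^sup>2 * b - a) * (b - q\<^sup>2 * a) * \<psi> (False # True # l) = 0" for l
    proof -
      \<comment> \<open>Cramer's rule: this combination of \<open>e1\<close> and \<open>e2\<close>
        eliminates the coordinate at \<open>True # False # l\<close>.\<close>
      have "(q * (b - a))\<^sup>2 * \<psi> (False # True # l) - a * (q\<^sup>2 - 1) * (b * (q\<^sup>2 - 1)) * \<psi> (False # True # l)
        = q * (b - a) * (a * (q\<^sup>2 - 1) * \<psi> (True # False # l) + q * (b - a) * \<psi> (False # True # l))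
        - a * (q\<^sup>2 - 1) * (q * (b - a) * \<psi> (True # False # l) + b * (q\<^sup>2 - 1) * \<psi> (False # True # l))"
        by (simp add: algebra_simps power2_eq_square)
      with e1[of l] e2[of l] show ?thesis unfolding det by (simp add: algebra_simps)
    qed
    with False assms have ft: "\<psi> (False # True # l) = 0" for l by auto
    with e1 assms have tf: "\<psi> (True # False # l) = 0" for l by auto
    have "\<psi> l = 0" for l
      using 0 pp ft tf by (cases "(q, \<psi>, l)" rule: cup.cases) auto
    with False show ?thesis by auto
  qed
qed

lemma inj_cup: "inj (cup q)"
proof (rule injI)
  fix \<phi> \<phi>' assume eq: "cup q \<phi> = cup q \<phi>'"
  have "\<phi> l = \<phi>' l" for l
    using fun_cong[OF eq, of "False # True # l"] by simp
  then show "\<phi> = \<phi>'" by blast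
qed

lemma has_inv_cup:
  assumes "q \<noteq> 0" "a \<noteq> 0" "has_inv q (us @ vs)"
  shows "has_inv q (us @ a # (q\<^sup>2 * a) # vs)"
proof -
  obtain \<psi> where \<psi>: "inv_tensor q (us @ vs) \<psi>" "\<psi> \<noteq> (\<lambda>l. 0)"
    using assms(3) by (auto simp: has_inv_def)
  let ?J = "(lift1 ^^ length us) (cup q)"
  have I: "intertwiner q (us @ vs) (us @ a # (q\<^sup>2 * a) # vs) ?J"
    by (intro intertwiner_lift intertwiner_cup assms)
  then have J0: "?J (\<lambda>l. 0) = (\<lambda>l. 0)"
    by (auto simp: intertwiner_def dest!: spec[of _ 0])
  have "?J \<psi> \<noteq> (\<lambda>l. 0)"
    using \<psi>(2) J0 injD[OF inj_lift[OF inj_cup], of "length us" q \<psi> "\<lambda>l. 0"] by auto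
  with I \<psi>(1) show ?thesis by (rule has_inv_intertwiner)
qed

text \<open>Either the R-matrix keeps the invariant nonzero, or the invariant lies in the image of
  \<open>cup\<close>, whose injectivity makes the preimage invariant under the shorter product. The
  assumption \<open>a \<noteq> q\<^sup>2 * b\<close> avoids the other degeneration, where the kernel
  of the R-matrix is three-dimensional.\<close>

lemma has_inv_swap:
  assumes "q \<noteq> 0" "q\<^sup>2 \<noteq> 1" "a \<noteq> q\<^sup>2 * b" "a \<noteq> 0" "b \<noteq> 0" "has_inv q (us @ a # b # vs)"
  shows "has_inv q (us @ b # a # vs) \<or> b = q\<^sup>2 * a \<and> has_inv q (us @ vs)"
proof -
  obtain \<psi> where \<psi>: "inv_tensor q (us @ a # b # vs) \<psi>" "\<psi> \<noteq> (\<lambda>l. 0)"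
    using assms(6) by (auto simp: has_inv_def)
  let ?k = "length us"
  let ?R = "(lift1 ^^ ?k) (rmat q a b)"
  have I: "intertwiner q (us @ a # b # vs) (us @ b # a # vs) ?R"
    by (intro intertwiner_lift intertwiner_rmat assms)
  show ?thesis
  proof (cases "?R \<psi> = (\<lambda>l. 0)")
    case False
    with I \<psi>(1) show ?thesis by (auto intro: has_inv_intertwiner)
  next
    case True
    have supp: "\<forall>l. length l < ?k + 2 \<longrightarrow> \<psi> l = 0"
      using inv_tensor_support[OF \<psi>(1)] by auto
    note k = ker_within_lift[OF ker_within_rmat[OF assms(1-5)], of ?k, unfolded ker_within_def,
        rule_format, OF supp[rule_format] True]
    show ?thesis
    proof (cases "b = q\<^sup>2 * a")
      case b: True
      let ?J = "(lift1 ^^ ?k) (cup q)"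
      from k b obtain \<phi> where \<phi>: "\<psi> = ?J \<phi>" by auto
      have J: "intertwiner q (us @ vs) (us @ a # b # vs) ?J"
        unfolding b by (intro intertwiner_lift intertwiner_cup assms)
      have "inv_tensor q (us @ vs) \<phi>"
        using inv_tensor_reflect[OF J inj_lift[OF inj_cup]] \<psi>(1) \<phi> by simp
      moreover have "\<phi> \<noteq> (\<lambda>l. 0)"
        using \<psi>(2) \<phi> J by (auto simp: intertwiner_def dest!: spec[of _ 0])
      ultimately show ?thesis using b by (auto simp: has_inv_def)
    next
      case False
      \<comment> \<open>A lift of the zero map is not zero on lists shorter than \<open>k\<close>,
        because \<open>lift1\<close> keeps the coordinate at the empty list; there
        \<open>supp\<close> takes over.\<close>
      have "(lift1 ^^ k) (\<lambda>\<phi> l. 0) \<phi> l = 0" if "k \<le> length l" for k \<phi> l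
        using that
      proof (induction k arbitrary: l \<phi>)
        case (Suc k)
        then show ?case by (cases l) auto
      qed simp
      moreover obtain \<phi> where "\<psi> = (lift1 ^^ ?k) (\<lambda>\<phi> l. 0) \<phi>"
        using k False by auto
      ultimately have "\<psi> l = 0" for l
        using supp by (cases "length l < ?k + 2") auto
      with \<psi>(2) show ?thesis by auto
    qed
  qed
qed

lemma has_inv_swap_generic:
  assumes "q \<noteq> 0" "q\<^sup>2 \<noteq> 1" "a \<noteq> q\<^sup>2 * b" "b \<noteq> q\<^sup>2 * a" "a \<noteq> 0" "b \<noteq> 0"
    and "has_inv q (us @ a # b # vs)"
  shows "has_inv q (us @ b # a # vs)"
  using has_inv_swap[of q a b us vs] assms by auto

section \<open>Rotation and deformation of the parameters\<close>

text \<open>Coassociativity: the recursion for the iterated coproduct may also be run from the right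
  end. Rotation needs this for the factor that is appended there.\<close>

lemma uop_snoc:
  assumes q: "q \<noteq> 0" and "length l = length zs"
  shows "uop q g (zs @ [u]) \<psi> (l @ [True]) = (case g of
      Kp \<Rightarrow> q * uop q Kp zs (\<lambda>l. \<psi> (l @ [True])) l
    | Km \<Rightarrow> 1 / q * uop q Km zs (\<lambda>l. \<psi> (l @ [True])) l
    | E0 \<Rightarrow> 1 / q * uop q E0 zs (\<lambda>l. \<psi> (l @ [True])) l
    | F0 \<Rightarrow> uop q F0 zs (\<lambda>l. \<psi> (l @ [True])) l + 1 / u * uop q Kp zs (\<lambda>l. \<psi> (l @ [False])) l
    | E1 \<Rightarrow> q * uop q E1 zs (\<lambda>l. \<psi> (l @ [True])) l + \<psi> (l @ [False])
    | F1 \<Rightarrow> uop q F1 zs (\<lambda>l. \<psi> (l @ [True])) l)" (is "_ = ?T g zs \<psi> l")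
    and "uop q g (zs @ [u]) \<psi> (l @ [False]) = (case g of
      Kp \<Rightarrow> 1 / q * uop q Kp zs (\<lambda>l. \<psi> (l @ [False])) l
    | Km \<Rightarrow> q * uop q Km zs (\<lambda>l. \<psi> (l @ [False])) l
    | E0 \<Rightarrow> q * uop q E0 zs (\<lambda>l. \<psi> (l @ [False])) l + u * \<psi> (l @ [True])
    | F0 \<Rightarrow> uop q F0 zs (\<lambda>l. \<psi> (l @ [False])) l
    | E1 \<Rightarrow> 1 / q * uop q E1 zs (\<lambda>l. \<psi> (l @ [False])) l
    | F1 \<Rightarrow> uop q F1 zs (\<lambda>l. \<psi> (l @ [False])) l + uop q Km zs (\<lambda>l. \<psi> (l @ [True])) l)"
    (is "_ = ?F g zs \<psi> l")
proof -
  have "uop q g (zs @ [u]) \<psi> (l @ [True]) = ?T g zs \<psi> l \<and>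
      uop q g (zs @ [u]) \<psi> (l @ [False]) = ?F g zs \<psi> l"
    using assms(2)
  proof (induction zs arbitrary: g \<psi> l)
    case Nil
    then show ?case by (auto simp: eps_def split: uq_gen.split)
  next
    case (Cons z zs)
    then obtain b l' where l: "l = b # l'" "length l' = length zs"
      by (cases l) auto
    show ?case
      unfolding l(1) using Cons.IH[OF l(2)] q
      by (cases b; cases g) (simp_all add: field_simps)
  qed
  then show "uop q g (zs @ [u]) \<psi> (l @ [True]) = ?T g zs \<psi> l"
    and "uop q g (zs @ [u]) \<psi> (l @ [False]) = ?F g zs \<psi> l" by auto
qed

text \<open>Comparing slices by first letter turns invariance into relations inside the remaining
  factors. With \<open>x\<close> as v_- and -q \<open>y\<close> as v_+ these are the relations of
  the evaluation module with parameter q^2 z, the dual of the first factor.\<close>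

lemma inv_tensor_Cons:
  assumes "q \<noteq> 0" "z \<noteq> 0" "inv_tensor q (z # zs) \<psi>"
    and xy: "x = (\<lambda>l. \<psi> (True # l))" "y = (\<lambda>l. \<psi> (False # l))"
  shows "uop q Kp zs x = (\<lambda>l. 1 / q * x l)" "uop q Kp zs y = (\<lambda>l. q * y l)"
    "uop q Km zs x = (\<lambda>l. q * x l)" "uop q Km zs y = (\<lambda>l. 1 / q * y l)"
    "uop q E1 zs x = (\<lambda>l. - q * y l)" "uop q E1 zs y = (\<lambda>l. 0)"
    "uop q F1 zs x = (\<lambda>l. 0)" "uop q F1 zs y = (\<lambda>l. - 1 / q * x l)"
    "uop q E0 zs x = (\<lambda>l. 0)" "uop q E0 zs y = (\<lambda>l. - z * q * x l)"
    "uop q F0 zs x = (\<lambda>l. - 1 / (z * q) * y l)" "uop q F0 zs y = (\<lambda>l. 0)"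
proof -
  have *: "uop q g (z # zs) \<psi> (b # l) = eps g * \<psi> (b # l)" for g b l
    using assms(3) by (simp add: inv_tensor_def)
  have x: "\<psi> (True # l) = x l" and y: "\<psi> (False # l) = y l" for l
    using xy by auto
  note T = *[where b = True, unfolded uop.simps x y] and F = *[where b = False, unfolded uop.simps x y]
  show kx: "uop q Kp zs x = (\<lambda>l. 1 / q * x l)"
    using T[where g = Kp] assms(1) by (auto simp: eps_def field_simps)
  show ky: "uop q Kp zs y = (\<lambda>l. q * y l)"
    using F[where g = Kp] assms(1) by (auto simp: eps_def field_simps)
  show mx: "uop q Km zs x = (\<lambda>l. q * x l)"
    using T[where g = Km] assms(1) by (auto simp: eps_def field_simps)
  show "uop q Km zs y = (\<lambda>l. 1 / q * y l)"
    using F[where g = Km] assms(1) by (auto simp: eps_def field_simps)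
  show "uop q E1 zs x = (\<lambda>l. - q * y l)"
    using T[where g = E1] by (auto simp: eps_def ky eq_neg_iff_add_eq_0 add.commute)
  show "uop q E1 zs y = (\<lambda>l. 0)"
    using F[where g = E1] by (auto simp: eps_def)
  show "uop q F1 zs x = (\<lambda>l. 0)"
    using T[where g = F1] assms(1) by (auto simp: eps_def)
  show "uop q F1 zs y = (\<lambda>l. - 1 / q * x l)"
    using F[where g = F1] assms(1) by (auto simp: eps_def field_simps eq_neg_iff_add_eq_0)
  show "uop q E0 zs x = (\<lambda>l. 0)"
    using T[where g = E0] by (auto simp: eps_def)
  show "uop q E0 zs y = (\<lambda>l. - z * q * x l)"
    using F[where g = E0] by (auto simp: eps_def mx eq_neg_iff_add_eq_0 algebra_simps)
  show "uop q F0 zs x = (\<lambda>l. - 1 / (z * q) * y l)"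
    using T[where g = F0] assms(1,2) by (auto simp: eps_def field_simps eq_neg_iff_add_eq_0)
  show "uop q F0 zs y = (\<lambda>l. 0)"
    using F[where g = F0] assms(1) by (auto simp: eps_def)
qed

text \<open>
  An invariant of $z \otimes M$ is a homomorphism from the dual of $z$ to $M$. The dual has
  parameter $q^2 z$, and it is also the dual on the other side of the module with parameter $q^4 z$.
\<close>

lemma has_inv_rotate:
  assumes q: "q \<noteq> 0" and z: "z \<noteq> 0" and "has_inv q (z # zs)"
  shows "has_inv q (zs @ [z * q ^ 4])"
proof -
  obtain \<psi> where \<psi>: "inv_tensor q (z # zs) \<psi>" "\<psi> \<noteq> (\<lambda>l. 0)"
    using assms(3) by (auto simp: has_inv_def)
  define x y where "x = (\<lambda>l. \<psi> (True # l))" and "y = (\<lambda>l. \<psi> (False # l))"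
  note rel = inv_tensor_Cons[OF q z \<psi>(1) x_def y_def]
  \<comment> \<open>On the vector c x v_+ + y v_- the generator \<open>E1\<close> gives (1 - c q^2)
    y v_+, so c must be q^(-2). Then \<open>E0\<close> gives (c u - z q^2) x v_- when the new last
    factor has parameter u, hence u = z q^4.\<close>
  obtain c where c: "c * q * q = 1"
    using q by (metis nonzero_eq_divide_eq divide_eq_eq mult.assoc times_divide_eq_left)
  define \<phi> :: tensor where "\<phi> l = (if l = [] then 0 else if last l then c * x (butlast l)
    else y (butlast l))" for l
  have \<phi>T: "(\<lambda>l. \<phi> (l @ [True])) = (\<lambda>l. c * x l)"
    and \<phi>F: "(\<lambda>l. \<phi> (l @ [False])) = y" by (auto simp: \<phi>_def)
  have supp: "\<phi> l = 0" if "length l \<noteq> length (zs @ [z * q ^ 4])" for l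
    using that inv_tensor_support[OF \<psi>(1), of "_ # butlast l"]
    by (cases l rule: rev_cases) (auto simp: \<phi>_def x_def y_def)
  have "uop q g (zs @ [z * q ^ 4]) \<phi> l = eps g * \<phi> l" for g l
  proof (cases "length l = length (zs @ [z * q ^ 4])")
    case True
    then obtain l' b where l: "l = l' @ [b]" "length l' = length zs"
      by (cases l rule: rev_cases) auto
    have \<phi>: "\<phi> (l' @ [True]) = c * x l'" "\<phi> (l' @ [False]) = y l'"
      by (simp_all add: \<phi>_def)
    have c': "c = 1 / (q * q)"
      using c q by (simp add: field_simps)
    show ?thesis
      unfolding l(1)
      by (cases b; cases g; simp add: uop_snoc[OF q l(2)] \<phi>T \<phi>F \<phi> uop_scale rel eps_def;
        use q z in \<open>simp add: c' field_simps power4_eq_xxxx\<close>)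
  next
    case False
    then show ?thesis
      using uop_support[OF supp False] supp by simp
  qed
  moreover have "\<phi> \<noteq> (\<lambda>l. 0)"
  proof
    assume "\<phi> = (\<lambda>l. 0)"
    then have "x l = 0 \<and> y l = 0" for l
      using fun_cong[OF \<phi>T, of l] fun_cong[OF \<phi>F, of l] c by auto
    moreover have "\<psi> [] = 0"
      using inv_tensor_support[OF \<psi>(1)] by simp
    ultimately have "\<psi> l = 0" for l
      unfolding x_def y_def by (cases l; cases "hd l") auto
    with \<psi>(2) show False by auto
  qed
  ultimately show ?thesis by (auto simp: has_inv_def inv_tensor_def)
qed

text \<open>In the dual copy spanned by the two slices, \<open>F0\<close> takes \<open>x\<close> to
  a multiple of \<open>y\<close> and \<open>F1\<close> takes it back, so the first parameter is
  visible as an eigenvalue on the other factors. If \<open>x\<close> vanished, so would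
  \<open>y\<close>, by the relation for \<open>E1\<close>.\<close>

lemma has_inv_Cons_eigen:
  assumes q: "q \<noteq> 0" and z: "z \<noteq> 0" and "has_inv q (z # zs)"
  obtains x where "x \<noteq> (\<lambda>l. 0)" "\<And>l. length l \<noteq> length zs \<Longrightarrow> x l = 0"
    "uop q F1 zs (uop q F0 zs x) = (\<lambda>l. 1 / (z * q\<^sup>2) * x l)"
proof -
  obtain \<psi> where \<psi>: "inv_tensor q (z # zs) \<psi>" "\<psi> \<noteq> (\<lambda>l. 0)"
    using assms(3) by (auto simp: has_inv_def)
  define x y where "x = (\<lambda>l. \<psi> (True # l))" and "y = (\<lambda>l. \<psi> (False # l))"
  note rel = inv_tensor_Cons[OF q z \<psi>(1) x_def y_def]
  have "uop q F1 zs (uop q F0 zs x) = (\<lambda>l. 1 / (z * q\<^sup>2) * x l)"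
    unfolding rel(11) using uop_scale[of q F1 zs "- 1 / (z * q)" y] rel(8)
    by (auto simp: power2_eq_square mult.assoc)
  moreover have "x l = 0" if "length l \<noteq> length zs" for l
    using inv_tensor_support[OF \<psi>(1), of "True # l"] that by (simp add: x_def)
  moreover have "x \<noteq> (\<lambda>l. 0)"
  proof
    assume x: "x = (\<lambda>l. 0)"
    then have "y l = 0" for l
      using fun_cong[OF rel(5), of l] q by simp
    moreover have "\<psi> [] = 0"
      using inv_tensor_support[OF \<psi>(1)] by simp
    ultimately have "\<psi> l = 0" for l
      using fun_cong[OF x] unfolding x_def y_def by (cases l; cases "hd l") auto
    with \<psi>(2) show False by auto
  qed
  ultimately show ?thesis using that by blast
qed

section \<open>Continuity in the parameters, limits of invariants, insertion of an arc\<close>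

lemma uop_tendsto:
  assumes "list_all2 (\<lambda>f z. f \<longlonglongrightarrow> z \<and> z \<noteq> 0) fs zs"
    and "\<And>l. (\<lambda>m. \<Psi> m l) \<longlonglongrightarrow> \<psi> l" and q: "q \<noteq> 0"
  shows "(\<lambda>m. uop q g (map (\<lambda>f. f m) fs) (\<Psi> m) l) \<longlonglongrightarrow> uop q g zs \<psi> l"
  using assms(1,2)
proof (induction arbitrary: g \<Psi> \<psi> l rule: list_all2_induct)
  case Nil
  then show ?case by (cases "l = []") (auto intro: tendsto_mult_left)
next
  case (Cons f fs z zs)
  show ?case
  proof (cases l)
    case (Cons b l')
    \<comment> \<open>A nonzero limit is required by the coefficient 1 / z in the action of
      \<open>F0\<close>.\<close>
    have f: "f \<longlonglongrightarrow> z" "z \<noteq> 0"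
      using Cons.hyps by auto
    have *: "(\<lambda>m. uop q g (map (\<lambda>f. f m) fs) (\<lambda>l. \<Psi> m (b # l)) l') \<longlonglongrightarrow> uop q g zs (\<lambda>l. \<psi> (b # l)) l'"
      for g b by (rule Cons.IH) (rule Cons.prems)
    show ?thesis
      unfolding Cons using f q by (cases b; cases g) (auto intro!: tendsto_intros * Cons.prems)
  qed simp
qed

text \<open>Bolzano-Weierstrass, from a monotone subsequence of the real parts and then one of the
  imaginary parts.\<close>

lemma bounded_complex_convergent_subseq:
  fixes f :: "nat \<Rightarrow> complex"
  assumes "\<And>m. norm (f m) \<le> c"
  obtains r l where "strict_mono r" "(\<lambda>m. f (r m)) \<longlonglongrightarrow> l"
proof -
  have real: "\<exists>r. strict_mono r \<and> convergent (\<lambda>m. g (r m))" if "\<And>m. \<bar>g m\<bar> \<le> c" for g :: "nat \<Rightarrow> real"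
  proof -
    obtain r where r: "strict_mono r" "monoseq (\<lambda>m. g (r m))"
      using seq_monosub[of g] by blast
    moreover have "Bseq (\<lambda>m. g (r m))"
      using that by (intro BseqI'[of _ c]) simp
    ultimately show ?thesis
      using Bseq_monoseq_convergent by blast
  qed
  obtain r where r: "strict_mono r" "convergent (\<lambda>m. Re (f (r m)))"
    using real[of "\<lambda>m. Re (f m)"] assms abs_Re_le_cmod order_trans by blast
  obtain s where s: "strict_mono s" "convergent (\<lambda>m. Im (f (r (s m))))"
    using real[of "\<lambda>m. Im (f (r m))"] assms abs_Im_le_cmod order_trans by blast
  obtain x y where x: "(\<lambda>m. Re (f (r m))) \<longlonglongrightarrow> x" and y: "(\<lambda>m. Im (f (r (s m)))) \<longlonglongrightarrow> y"
    using r(2) s(2) by (auto simp: convergent_def)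
  have "(\<lambda>m. Re (f (r (s m)))) \<longlonglongrightarrow> x"
    using LIMSEQ_subseq_LIMSEQ[OF x s(1)] by (simp add: o_def)
  with y have "(\<lambda>m. f ((r \<circ> s) m)) \<longlonglongrightarrow> Complex x y"
    by (simp add: tendsto_complex_iff)
  moreover have "strict_mono (r \<circ> s)"
    using r(1) s(1) by (rule strict_mono_o)
  ultimately show ?thesis using that by blast
qed

lemma convergent_subseq_finite:
  fixes \<Psi> :: "nat \<Rightarrow> 'a \<Rightarrow> complex"
  assumes "finite L" "\<And>m l. l \<in> L \<Longrightarrow> norm (\<Psi> m l) \<le> c"
  shows "\<exists>r \<phi>. strict_mono r \<and> (\<forall>l\<in>L. (\<lambda>m. \<Psi> (r m) l) \<longlonglongrightarrow> \<phi> l)"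
  using assms
proof (induction rule: finite_induct)
  case empty
  show ?case by (auto intro: exI[of _ id] strict_mono_id)
next
  case (insert a L)
  then obtain r \<phi> where r: "strict_mono r" "\<forall>l\<in>L. (\<lambda>m. \<Psi> (r m) l) \<longlonglongrightarrow> \<phi> l"
    by auto
  obtain s b where s: "strict_mono s" "(\<lambda>m. \<Psi> (r (s m)) a) \<longlonglongrightarrow> b"
    by (rule bounded_complex_convergent_subseq[of "\<lambda>m. \<Psi> (r m) a" c]) (use insert.prems in auto)
  have "(\<lambda>m. \<Psi> ((r \<circ> s) m) l) \<longlonglongrightarrow> (\<phi>(a := b)) l" if "l \<in> insert a L" for l
  proof (cases "l = a")
    case True
    with s show ?thesis by (simp add: o_def)
  next
    case False
    with that r(2) s(1) show ?thesis
      using LIMSEQ_subseq_LIMSEQ[of "\<lambda>m. \<Psi> (r m) l" "\<phi> l" s] by (auto simp: o_def)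
  qed
  moreover have "strict_mono (r \<circ> s)"
    using r s by (simp add: strict_mono_o)
  ultimately show ?case by blast
qed

text \<open>Having an invariant is a closed condition: invariants scaled to l1-norm 1 range in a
  compact set, the equations pass to a limit point, and its norm is still 1, so it is not
  zero.\<close>

lemma has_inv_limit:
  assumes q: "q \<noteq> 0" and lim: "list_all2 (\<lambda>f z. f \<longlonglongrightarrow> z \<and> z \<noteq> 0) fs zs"
    and inv: "\<And>m. has_inv q (map (\<lambda>f. f m) fs)"
  shows "has_inv q zs"
proof -
  define L :: "bool list set" where "L = {l. length l = length zs}"
  have L: "finite L"
    using finite_lists_length_eq[of "UNIV :: bool set"] by (simp add: L_def)
  have len: "length fs = length zs"
    using lim by (rule list_all2_lengthD)
  have "\<exists>\<psi>. inv_tensor q (map (\<lambda>f. f m) fs) \<psi> \<and> (\<Sum>l\<in>L. norm (\<psi> l)) = 1" for m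
  proof -
    obtain \<psi> where \<psi>: "inv_tensor q (map (\<lambda>f. f m) fs) \<psi>" "\<psi> \<noteq> (\<lambda>l. 0)"
      using inv[of m] by (auto simp: has_inv_def)
    then obtain l where l: "\<psi> l \<noteq> 0" by auto
    then have "l \<in> L"
      using inv_tensor_support[OF \<psi>(1), of l] len by (auto simp: L_def)
    define c where "c = (\<Sum>l\<in>L. norm (\<psi> l))"
    have "c > 0"
      unfolding c_def using L \<open>l \<in> L\<close> l by (intro sum_pos2[of L l]) auto
    define d where "d = complex_of_real (1 / c)"
    have "inv_tensor q (map (\<lambda>f. f m) fs) (\<lambda>l. d * \<psi> l)"
      using \<psi>(1) by (simp add: inv_tensor_def uop_scale)
    moreover have "(\<Sum>l\<in>L. norm (d * \<psi> l)) = 1"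
      using \<open>c > 0\<close> unfolding norm_mult sum_distrib_left[symmetric] c_def[symmetric]
      by (simp add: d_def norm_divide)
    ultimately show ?thesis by blast
  qed
  then obtain \<Psi> where \<Psi>: "\<And>m. inv_tensor q (map (\<lambda>f. f m) fs) (\<Psi> m)"
      "\<And>m. (\<Sum>l\<in>L. norm (\<Psi> m l)) = 1"
    by metis
  have "norm (\<Psi> m l) \<le> 1" if "l \<in> L" for m l
    using member_le_sum[OF that, of "\<lambda>l. norm (\<Psi> m l)"] L \<Psi>(2)[of m] by simp
  from convergent_subseq_finite[of L \<Psi> 1, OF L this] obtain r \<phi>
    where r: "strict_mono r" "\<And>l. l \<in> L \<Longrightarrow> (\<lambda>m. \<Psi> (r m) l) \<longlonglongrightarrow> \<phi> l"
    by blast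
  \<comment> \<open>The limits in \<open>r\<close> are known only on \<open>L\<close>; elsewhere
    every \<open>\<Psi> m\<close> is 0 by its support, so 0 is the right value.\<close>
  define \<psi> where "\<psi> l = (if l \<in> L then \<phi> l else 0)" for l
  have 0: "\<Psi> m l = 0" if "l \<notin> L" for m l
    using inv_tensor_support[OF \<Psi>(1)] that len by (auto simp: L_def)
  have lim\<psi>: "(\<lambda>m. \<Psi> (r m) l) \<longlonglongrightarrow> \<psi> l" for l
    using r(2)[of l] 0[of l] by (cases "l \<in> L") (auto simp: \<psi>_def)
  have lim': "list_all2 (\<lambda>f z. f \<longlonglongrightarrow> z \<and> z \<noteq> 0) (map (\<lambda>f. f \<circ> r) fs) zs"
    unfolding list.rel_map
    by (rule list.rel_mono_strong[OF lim]) (auto simp: o_def dest: LIMSEQ_subseq_LIMSEQ[OF _ r(1)])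
  have "uop q g zs \<psi> l = eps g * \<psi> l" for g l
  proof (rule LIMSEQ_unique)
    show "(\<lambda>m. uop q g (map (\<lambda>f. f m) (map (\<lambda>f. f \<circ> r) fs)) (\<Psi> (r m)) l) \<longlonglongrightarrow> uop q g zs \<psi> l"
      by (rule uop_tendsto[OF lim' lim\<psi> q])
    have "uop q g (map (\<lambda>f. f m) (map (\<lambda>f. f \<circ> r) fs)) (\<Psi> (r m)) l = eps g * \<Psi> (r m) l" for m
      using \<Psi>(1)[of "r m"] by (simp add: inv_tensor_def o_def)
    then show "(\<lambda>m. uop q g (map (\<lambda>f. f m) (map (\<lambda>f. f \<circ> r) fs)) (\<Psi> (r m)) l)
        \<longlonglongrightarrow> eps g * \<psi> l"
      by (simp only:) (intro tendsto_intros lim\<psi>)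
  qed
  moreover have "(\<Sum>l\<in>L. norm (\<psi> l)) = 1"
  proof (rule LIMSEQ_unique)
    show "(\<lambda>m. \<Sum>l\<in>L. norm (\<Psi> (r m) l)) \<longlonglongrightarrow> (\<Sum>l\<in>L. norm (\<psi> l))"
      by (intro tendsto_intros lim\<psi>)
    show "(\<lambda>m. \<Sum>l\<in>L. norm (\<Psi> (r m) l)) \<longlonglongrightarrow> 1"
      by (simp add: \<Psi>(2))
  qed
  then have "\<psi> \<noteq> (\<lambda>l. 0)" by auto
  ultimately show ?thesis by (auto simp: has_inv_def inv_tensor_def)
qed

text \<open>The arc is created with adjacent ends by \<open>cup\<close>, and its right end passes
  the letters of \<open>vs\<close> one by one. Exchanging \<open>q\<^sup>2 * z\<close> with
  \<open>v\<close> degenerates only for \<open>v = z\<close> and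
  \<open>v = q ^ 4 * z\<close>.\<close>

lemma has_inv_insert_generic:
  assumes "q \<noteq> 0" "q\<^sup>2 \<noteq> 1" "z \<noteq> 0" "0 \<notin> set vs"
    and "z \<notin> set vs" "q ^ 4 * z \<notin> set vs" "has_inv q (us @ vs @ ws)"
  shows "has_inv q (us @ z # vs @ (q\<^sup>2 * z) # ws)"
proof -
  have *: "has_inv q (us @ xs @ (q\<^sup>2 * z) # ys @ ws) \<Longrightarrow> set ys \<subseteq> set vs \<Longrightarrow>
      has_inv q (us @ xs @ ys @ (q\<^sup>2 * z) # ws)" for xs ys
  proof (induction ys arbitrary: xs)
    case (Cons v ys)
    have "has_inv q ((us @ xs) @ v # (q\<^sup>2 * z) # ys @ ws)"
    proof (rule has_inv_swap_generic)
      show "has_inv q ((us @ xs) @ (q\<^sup>2 * z) # v # ys @ ws)"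
        using Cons.prems(1) by simp
      have "v \<noteq> z" "v \<noteq> q ^ 4 * z" "v \<noteq> 0"
        using Cons.prems(2) assms by auto
      then show "q\<^sup>2 * z \<noteq> q\<^sup>2 * v" "v \<noteq> q\<^sup>2 * (q\<^sup>2 * z)" "v \<noteq> 0"
        using assms(1) by (auto simp: power2_eq_square power4_eq_xxxx mult.assoc)
    qed (use assms in auto)
    then show ?case
      using Cons.IH[of "xs @ [v]"] Cons.prems(2) by simp
  qed simp
  have "has_inv q (us @ z # (q\<^sup>2 * z) # vs @ ws)"
    using assms by (intro has_inv_cup) auto
  then show ?thesis
    using *[of "[z]" vs] by simp
qed

text \<open>
  At special $z$ the R-matrices moving the end of the arc past \<open>vs\<close> may kill the invariant. So $z$ is
  approximated by generic parameters, for which they are bijective.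
\<close>

lemma has_inv_insert:
  assumes q: "q \<noteq> 0" "q\<^sup>2 \<noteq> 1" and z: "z \<noteq> 0" and nz: "0 \<notin> set (us @ vs @ ws)"
    and inv: "has_inv q (us @ vs @ ws)"
  shows "has_inv q (us @ z # vs @ (q\<^sup>2 * z) # ws)"
proof -
  \<comment> \<open>Any injective sequence of nonzero numbers tending to \<open>z\<close> would do:
    injectivity makes it meet the finitely many exceptional values only finitely often.\<close>
  define s where "s m = z * (1 + 1 / of_nat (Suc m))" for m
  have "inj s"
    using z by (auto simp: inj_def s_def simp del: of_nat_Suc)
  have "finite (s -` (set vs \<union> (\<lambda>v. v / q ^ 4) ` set vs))"
    by (intro finite_vimageI \<open>inj s\<close>) auto
  then obtain N where N: "\<And>m. s m \<in> set vs \<union> (\<lambda>v. v / q ^ 4) ` set vs \<Longrightarrow> m \<le> N"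
    by (metis finite_nat_set_iff_bounded_le vimageI)
  \<comment> \<open>Dropping the first \<open>Suc N\<close> terms leaves only generic
    parameters.\<close>
  define t where "t m = s (m + Suc N)" for m
  have t: "t m \<notin> set vs" "q ^ 4 * t m \<notin> set vs" for m
  proof -
    have *: "t m \<notin> set vs \<union> (\<lambda>v. v / q ^ 4) ` set vs"
      using N[of "m + Suc N"] by (auto simp: t_def)
    then show "t m \<notin> set vs" by simp
    show "q ^ 4 * t m \<notin> set vs"
    proof
      assume "q ^ 4 * t m \<in> set vs"
      then have "q ^ 4 * t m / q ^ 4 \<in> (\<lambda>v. v / q ^ 4) ` set vs" by (rule imageI)
      with * q show False by simp
    qed
  qed
  have "s \<longlonglongrightarrow> z * (1 + 0)"
    unfolding s_def by (intro tendsto_intros LIMSEQ_Suc lim_1_over_n)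
  then have lim: "t \<longlonglongrightarrow> z"
    unfolding t_def using LIMSEQ_ignore_initial_segment[of s z "Suc N"] by simp
  have t0: "t m \<noteq> 0" for m
  proof -
    have "1 + 1 / of_nat (Suc k) = (of_nat (Suc (Suc k)) / of_nat (Suc k) :: complex)" for k
      unfolding of_nat_Suc[of "Suc k"] by (simp add: add_divide_distrib del: of_nat_Suc)
    then show ?thesis
      using z by (simp add: t_def s_def del: of_nat_Suc)
  qed
  \<comment> \<open>All letters other than the ends of the arc are kept as constant
    sequences.\<close>
  let ?c = "map (\<lambda>v m. v)"
  show ?thesis
  proof (rule has_inv_limit[OF q(1)])
    show "list_all2 (\<lambda>f z. f \<longlonglongrightarrow> z \<and> z \<noteq> 0) (?c us @ t # ?c vs @ (\<lambda>m. q\<^sup>2 * t m) # ?c ws)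
        (us @ z # vs @ (q\<^sup>2 * z) # ws)"
      using nz lim q z by (intro list_all2_appendI list.rel_intros)
        (auto simp: list.rel_map intro!: list.rel_refl_strong tendsto_intros)
    show "has_inv q (map (\<lambda>f. f m) (?c us @ t # ?c vs @ (\<lambda>m. q\<^sup>2 * t m) # ?c ws))" for m
      using has_inv_insert_generic[OF q t0[of m] _ t, of us ws] nz inv by (simp add: o_def)
  qed
qed

section \<open>Comparison with the matrix modules\<close>

text \<open>Binary notation with the first letter most significant and \<open>True\<close> as digit
  0: this is the lexicographic order of \<open>kron\<close> with v_+ before v_-.\<close>

fun enc :: "bool list \<Rightarrow> nat" where
  "enc [] = 0"
| "enc (b # l) = (if b then 0 else 2 ^ length l) + enc l"

lemma enc_less: "enc l < 2 ^ length l"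
  by (induction l) auto

lemma bij_betw_enc: "bij_betw enc {l. length l = n} {..<2 ^ n}"
proof -
  have "l = l'" if "length l = length l'" "enc l = enc l'" for l l'
    using that
  proof (induction l l' rule: list_induct2)
    case (Cons x xs y ys)
    then show ?case
      using enc_less[of xs] enc_less[of ys] by (auto split: if_splits)
  qed simp
  then have inj: "inj_on enc {l. length l = n}"
    by (auto intro!: inj_onI)
  moreover have sub: "enc ` {l. length l = n} \<subseteq> {..<2 ^ n}"
    using enc_less by auto
  moreover have "card (enc ` {l. length l = n}) = 2 ^ n"
    using card_image[OF inj] card_lists_length_eq[of "UNIV :: bool set" n] by simp
  ultimately show ?thesis
    by (simp add: bij_betw_def card_subset_eq)
qed

definition coords :: "nat \<Rightarrow> complex vec \<Rightarrow> tensor" where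
  "coords n v l = (if length l = n then v $ enc l else 0)"

lemma coords_inj:
  assumes "v \<in> carrier_vec (2 ^ n)" "v' \<in> carrier_vec (2 ^ n)" "coords n v = coords n v'"
  shows "v = v'"
proof (rule eq_vecI)
  fix i assume "i < dim_vec v'"
  then have "i \<in> enc ` {l. length l = n}"
    using assms(2) bij_betw_imp_surj_on[OF bij_betw_enc[of n]] by simp
  then obtain l where "length l = n" "i = enc l" by auto
  then show "v $ i = v' $ i"
    using fun_cong[OF assms(3), of l] by (simp add: coords_def)
qed (use assms in auto)

lemma coords_surj:
  assumes "\<And>l. length l \<noteq> n \<Longrightarrow> \<psi> l = 0"
  obtains v where "v \<in> carrier_vec (2 ^ n)" "coords n v = \<psi>"
proof
  let ?v = "vec (2 ^ n) (\<lambda>i. \<psi> (inv_into {l. length l = n} enc i))"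
  show "?v \<in> carrier_vec (2 ^ n)" by simp
  show "coords n ?v = \<psi>"
    using assms enc_less bij_betw_inv_into_left[OF bij_betw_enc[of n]]
    by (auto simp: coords_def fun_eq_iff)
qed

lemma coords_smult: "v \<in> carrier_vec (2 ^ n) \<Longrightarrow> coords n (c \<cdot>\<^sub>v v) l = c * coords n v l"
  using enc_less[of l] by (auto simp: coords_def)

lemma coords_zero: "coords n (0\<^sub>v (2 ^ n)) = (\<lambda>l. 0)"
  using enc_less by (fastforce simp: coords_def)

text \<open>A Kronecker product with a 2 by 2 left factor is a 2 by 2 block matrix. The two halves
  of \<open>v\<close> are its slices by the first letter.\<close>

lemma kron_mult_vec:
  assumes A: "A \<in> carrier_mat 2 2" and B: "B \<in> carrier_mat m m" and v: "v \<in> carrier_vec (2 * m)"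
    and i: "i < m" and s: "s < 2"
  shows "(kron A B *\<^sub>v v) $ (s * m + i) =
    A $$ (s, 0) * (B *\<^sub>v vec m (\<lambda>j. v $ j)) $ i + A $$ (s, 1) * (B *\<^sub>v vec m (\<lambda>j. v $ (m + j))) $ i"
proof -
  have k: "s * m + i < 2 * m"
  proof -
    have "s = 0 \<or> s = 1" using s by auto
    with i show ?thesis by auto
  qed
  have dm: "(s * m + i) div m = s" "(s * m + i) mod m = i"
    using i by auto
  have "(kron A B *\<^sub>v v) $ (s * m + i) =
      (\<Sum>j = 0..<2 * m. A $$ (s, j div m) * B $$ (i, j mod m) * v $ j)"
    using A B v k dm by (simp add: kron_def scalar_prod_def)
  also have "\<dots> = (\<Sum>j = 0..<m. A $$ (s, j div m) * B $$ (i, j mod m) * v $ j)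
      + (\<Sum>j = m..<2 * m. A $$ (s, j div m) * B $$ (i, j mod m) * v $ j)"
    by (rule sum.atLeastLessThan_concat[symmetric]) auto
  also have "(\<Sum>j = m..<2 * m. A $$ (s, j div m) * B $$ (i, j mod m) * v $ j)
      = (\<Sum>j = 0..<m. A $$ (s, 1) * (B $$ (i, j) * v $ (m + j)))"
  proof -
    have "(m + j) div m = 1" "(m + j) mod m = j" if "j < m" for j
      using that by (auto simp: div_add_self1)
    then show ?thesis
      unfolding mult_2
      using sum.shift_bounds_nat_ivl[of "\<lambda>j. A $$ (s, j div m) * B $$ (i, j mod m) * v $ j" 0 m m]
      by (auto simp: add.commute mult.assoc intro!: sum.cong)
  qed
  also have "(\<Sum>j = 0..<m. A $$ (s, j div m) * B $$ (i, j mod m) * v $ j)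
      = (\<Sum>j = 0..<m. A $$ (s, 0) * (B $$ (i, j) * v $ j))"
    by (intro sum.cong) auto
  finally show ?thesis
    using B i by (simp add: scalar_prod_def sum_distrib_left)
qed

lemma mdim_word_mod: "mdim (word_mod q w) = 2 ^ length w"
  by (induction w) (auto simp: word_mod_def trivial_mod_def tensor_mod_def eval_mod_def Let_def)

lemma word_mod_carrier':
  "gact (word_mod q w) g \<in> carrier_mat (2 ^ length w) (2 ^ length w)"
  using word_mod_carrier[of q w g] by (simp add: mdim_word_mod)

abbreviation params :: "complex \<Rightarrow> int list \<Rightarrow> complex list" where
  "params q \<equiv> map (\<lambda>a. q powi a)"

text \<open>Both \<open>word_mod\<close> and \<open>uop\<close> split off the first letter, so
  induction only has to match the block rows of each generator with the two clauses of
  \<open>uop\<close>.\<close>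

lemma coords_gact:
  assumes "v \<in> carrier_vec (2 ^ length w)"
  shows "coords (length w) (gact (word_mod q w) g *\<^sub>v v) = uop q g (params q w) (coords (length w) v)"
  using assms
proof (induction w arbitrary: v g)
  case Nil
  then show ?case
    by (cases g) (auto simp: fun_eq_iff coords_def word_mod_def trivial_mod_def eps_def)
next
  case (Cons a w)
  define n where "n = length w"
  define m where "m = (2::nat) ^ n"
  define v0 v1 where "v0 = vec m (\<lambda>j. v $ j)" and "v1 = vec m (\<lambda>j. v $ (m + j))"
  have v: "v \<in> carrier_vec (2 * m)"
    using Cons.prems by (simp add: m_def n_def)
  have v0: "v0 \<in> carrier_vec m" and v1: "v1 \<in> carrier_vec m"
    by (auto simp: v0_def v1_def)
  define W where "W = gact (word_mod q w)"
  have W: "W g \<in> carrier_mat m m" for g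
    using word_mod_carrier' by (simp add: W_def m_def n_def)
  have IH: "coords n (W g *\<^sub>v v0) = uop q g (params q w) (coords n v0)"
    "coords n (W g *\<^sub>v v1) = uop q g (params q w) (coords n v1)" for g
    using Cons.IH[of v0 g] Cons.IH[of v1 g] v0 v1 by (simp_all add: W_def m_def n_def)
  have c0: "(\<lambda>l. coords (Suc n) v (True # l)) = coords n v0"
    and c1: "(\<lambda>l. coords (Suc n) v (False # l)) = coords n v1"
    using enc_less by (auto simp: coords_def fun_eq_iff v0_def v1_def m_def)
  have ev: "gact (eval_mod q a) g \<in> carrier_mat 2 2" for g
    by (cases g) (auto simp: eval_mod_def mat_of_rows_list_def Let_def)
  have kr: "A \<in> carrier_mat 2 2 \<Longrightarrow> B \<in> carrier_mat m m \<Longrightarrow> coords (Suc n) (kron A B *\<^sub>v v) (b # l) =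
      A $$ (if b then 0 else 1, 0) * coords n (B *\<^sub>v v0) l + A $$ (if b then 0 else 1, 1) * coords n (B *\<^sub>v v1) l"
    for A B b l
    using kron_mult_vec[of A B m v "enc l" "if b then 0 else 1"] v enc_less[of l]
    by (auto simp: coords_def v0_def v1_def m_def)
  have kc: "A \<in> carrier_mat 2 2 \<Longrightarrow> B \<in> carrier_mat m m \<Longrightarrow> kron A B \<in> carrier_mat (2 * m) (2 * m)" for A B
    by (auto simp: kron_def)
  have add: "coords (Suc n) ((A + B) *\<^sub>v v) l = coords (Suc n) (A *\<^sub>v v) l + coords (Suc n) (B *\<^sub>v v) l"
    if "A \<in> carrier_mat (2 * m) (2 * m)" "B \<in> carrier_mat (2 * m) (2 * m)" for A B l
    using that v enc_less[of l]
    by (auto simp: add_mult_distrib_mat_vec[of A "2 * m" "2 * m" B v] coords_def m_def)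
  have md: "mdim (eval_mod q a) = 2" "mdim (word_mod q w) = m"
    by (auto simp: eval_mod_def Let_def mdim_word_mod m_def n_def)
  have g: "gact (word_mod q (a # w)) g = gact (tensor_mod (eval_mod q a) (word_mod q w)) g" for g
    by (simp add: word_mod_def)
  have E: "gact (eval_mod q a) Kp $$ (0, 0) = q" "gact (eval_mod q a) Kp $$ (0, Suc 0) = 0"
    "gact (eval_mod q a) Kp $$ (Suc 0, 0) = 0" "gact (eval_mod q a) Kp $$ (Suc 0, Suc 0) = 1 / q"
    "gact (eval_mod q a) Km $$ (0, 0) = 1 / q" "gact (eval_mod q a) Km $$ (0, Suc 0) = 0"
    "gact (eval_mod q a) Km $$ (Suc 0, 0) = 0" "gact (eval_mod q a) Km $$ (Suc 0, Suc 0) = q"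
    "gact (eval_mod q a) E1 $$ (0, 0) = 0" "gact (eval_mod q a) E1 $$ (0, Suc 0) = 1"
    "gact (eval_mod q a) E1 $$ (Suc 0, 0) = 0" "gact (eval_mod q a) E1 $$ (Suc 0, Suc 0) = 0"
    "gact (eval_mod q a) F1 $$ (0, 0) = 0" "gact (eval_mod q a) F1 $$ (0, Suc 0) = 0"
    "gact (eval_mod q a) F1 $$ (Suc 0, 0) = 1" "gact (eval_mod q a) F1 $$ (Suc 0, Suc 0) = 0"
    "gact (eval_mod q a) E0 $$ (0, 0) = 0" "gact (eval_mod q a) E0 $$ (0, Suc 0) = 0"
    "gact (eval_mod q a) E0 $$ (Suc 0, 0) = q powi a" "gact (eval_mod q a) E0 $$ (Suc 0, Suc 0) = 0"
    "gact (eval_mod q a) F0 $$ (0, 0) = 0" "gact (eval_mod q a) F0 $$ (0, Suc 0) = 1 / q powi a"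
    "gact (eval_mod q a) F0 $$ (Suc 0, 0) = 0" "gact (eval_mod q a) F0 $$ (Suc 0, Suc 0) = 0"
    by (simp_all add: eval_mod_def mat_of_rows_list_def Let_def power_int_minus divide_inverse)
  note carr = ev W[unfolded W_def] kc one_carrier_mat
  have "coords (Suc n) (gact (word_mod q (a # w)) g *\<^sub>v v) (b # l) =
      uop q g (params q (a # w)) (coords (Suc n) v) (b # l)" for b l
    unfolding g
    by (cases g; cases b)
      (simp_all add: tensor_mod_def md add kr carr E c0 c1 IH[unfolded W_def] v0 v1
        fun_cong[OF c0] fun_cong[OF c1])
  then have "coords (Suc n) (gact (word_mod q (a # w)) g *\<^sub>v v) l =
      uop q g (params q (a # w)) (coords (Suc n) v) l" for l
    by (cases l) (simp_all add: coords_def)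
  then show ?case
    by (auto simp: n_def)
qed

text \<open>By \<open>has_inv_Cons_eigen\<close> each such \<open>z\<close> yields an eigenvalue of
  one fixed matrix, the product of \<open>F1\<close> and \<open>F0\<close> on \<open>w\<close>, and
  a matrix has finitely many eigenvalues.\<close>

lemma finite_has_inv_Cons:
  assumes "q \<noteq> 0"
  shows "finite {z. z \<noteq> 0 \<and> has_inv q (z # params q w)}"
proof -
  let ?W = "gact (word_mod q w)" and ?m = "2 ^ length w"
  let ?A = "?W F1 * ?W F0"
  have W: "?W g \<in> carrier_mat ?m ?m" for g
    by (rule word_mod_carrier')
  have A: "?A \<in> carrier_mat ?m ?m"
    using W by (intro mult_carrier_mat)
  have "1 / (z * q\<^sup>2) \<in> spectrum ?A" if z: "z \<noteq> 0" "has_inv q (z # params q w)" for z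
  proof -
    obtain x where x: "x \<noteq> (\<lambda>l. 0)" "\<And>l. length l \<noteq> length w \<Longrightarrow> x l = 0"
      "uop q F1 (params q w) (uop q F0 (params q w) x) = (\<lambda>l. 1 / (z * q\<^sup>2) * x l)"
      by (rule has_inv_Cons_eigen[OF assms z]) (simp add: that)
    obtain v where v: "v \<in> carrier_vec ?m" "coords (length w) v = x"
      using coords_surj[of "length w" x] x(2) by blast
    have Wv: "?W F0 *\<^sub>v v \<in> carrier_vec ?m"
      using W[of F0] v(1) by (rule mult_mat_vec_carrier)
    have "coords (length w) (?A *\<^sub>v v) = coords (length w) ((1 / (z * q\<^sup>2)) \<cdot>\<^sub>v v)"
      using v Wv x(3) by (auto simp: assoc_mult_mat_vec[OF W W] coords_gact coords_smult)
    then have "?A *\<^sub>v v = (1 / (z * q\<^sup>2)) \<cdot>\<^sub>v v"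
      using A v by (intro coords_inj) auto
    moreover have "v \<noteq> 0\<^sub>v ?m"
      using x(1) v(2) by (auto simp: coords_zero)
    ultimately have "eigenvector ?A v (1 / (z * q\<^sup>2))"
      using A v by (auto simp: eigenvector_def)
    then show ?thesis
      by (auto simp: spectrum_def eigenvalue_def)
  qed
  \<comment> \<open>The map taking k to 1 / (k q^2) is its own inverse on nonzero numbers and
    recovers \<open>z\<close> from the eigenvalue.\<close>
  then have "{z. z \<noteq> 0 \<and> has_inv q (z # params q w)} \<subseteq> (\<lambda>k. 1 / (k * q\<^sup>2)) ` spectrum ?A"
    using assms by (force simp: image_iff)
  then show ?thesis
    using card_finite_spectrum(1)[OF A] finite_subset by blast
qed

section \<open>Dimension of the space of homomorphisms from the trivial module\<close>

lemma (in vectorspace) fin_dim_subspace: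
  assumes W: "VectorSpace.subspace K W V" and "fin_dim"
  shows "vectorspace.fin_dim K (vs W)"
proof -
  interpret W: vectorspace K "vs W"
    using W by (rule subspace_is_vs)
  \<comment> \<open>Independence in \<open>W\<close> carries over to the ambient space, which bounds
    the size. So a maximal independent set exists, and it generates \<open>W\<close>.\<close>
  have *: "finite A \<and> card A \<le> dim" if "A \<subseteq> carrier (vs W) \<and> W.lin_indpt A" for A
  proof -
    have sub: "A \<subseteq> W" "submodule K W V"
      using that W by (simp_all add: VectorSpace.subspace_def)
    then have "A \<subseteq> carrier V" "lin_indpt A"
      using that span_li_not_depend(2)[OF sub] by (auto simp: submodule_def)
    then show ?thesis
      using li_le_dim[OF assms(2)] by simp
  qed
  have 0: "{} \<subseteq> carrier (vs W) \<and> W.lin_indpt {}"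
    unfolding W.lin_dep_def by blast
  have "\<exists>A. finite A \<and> maximal A (\<lambda>A. A \<subseteq> carrier (vs W) \<and> W.lin_indpt A)"
    by (rule maximal_exists, fact *, fact 0)
  then obtain A where A: "finite A" "maximal A (\<lambda>A. A \<subseteq> carrier (vs W) \<and> W.lin_indpt A)"
    by (elim exE conjE)
  have "A \<subseteq> carrier (vs W)"
    using A(2) by (simp add: maximal_def)
  with A(1) W.max_li_is_gen[OF A(2)] show ?thesis
    unfolding W.fin_dim_def by (intro exI[of _ A] conjI)
qed

lemma (in vectorspace) dim_eq_0_iff:
  assumes "fin_dim"
  shows "dim = 0 \<longleftrightarrow> carrier V = {\<zero>\<^bsub>V\<^esub>}"
proof
  assume "dim = 0"
  obtain A where "finite A" "basis A"
    using finite_basis_exists[OF assms] by blast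
  with \<open>dim = 0\<close> have "A = {}"
    using dim_basis by fastforce
  with \<open>basis A\<close> show "carrier V = {\<zero>\<^bsub>V\<^esub>}"
    by (auto simp: basis_def span_empty)
next
  assume "carrier V = {\<zero>\<^bsub>V\<^esub>}"
  then have "gen_set {}"
    by (simp add: span_empty)
  then show "dim = 0"
    using gen_ge_dim[of "{}"] by simp
qed

lemma fin_dim_module_mat_1:
  "vectorspace.fin_dim class_ring (module_mat TYPE(complex) m 1)"
proof -
  let ?V = "module_vec TYPE(complex) m" and ?W = "module_mat TYPE(complex) m 1"
  define f :: "complex vec \<Rightarrow> complex mat" where "f v = mat m 1 (\<lambda>(i, _). v $ i)" for v
  have "f \<in> LinearCombinations.module_hom class_ring ?V ?W"
    unfolding LinearCombinations.module_hom_def module_vec_simps module_mat_simps class_ring_simps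
    by (auto simp: f_def)
  then have "linear_map class_ring ?V ?W f"
    by (intro linear_map.intro mod_hom.intro mod_hom_axioms.intro vec_vs matrix_vs
      vectorspace.axioms(1))
  moreover have "vectorspace.fin_dim class_ring ?V"
    by (rule vec_space.fin_dim)
  moreover have "f ` carrier ?V = carrier ?W"
  proof -
    have "A \<in> f ` carrier_vec m" if "A \<in> carrier_mat m 1" for A
      using that by (intro image_eqI[of _ _ "col A 0"] eq_matI) (auto simp: f_def)
    then show ?thesis
      by (auto simp: module_vec_simps module_mat_simps f_def)
  qed
  ultimately show ?thesis
    by (rule linear_map.surj_fin_dim)
qed

lemma uq_hom_iff_generators:
  assumes M: "\<And>g. gact M g \<in> carrier_mat (mdim M) (mdim M)"
    and N: "\<And>g. gact N g \<in> carrier_mat (mdim N) (mdim N)"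
  shows "T \<in> uq_hom M N \<longleftrightarrow> T \<in> carrier_mat (mdim N) (mdim M) \<and> (\<forall>g. T * gact M g = gact N g * T)"
proof -
  note m = act_carrier[of M, OF M] and n = act_carrier[of N, OF N]
  have "T * act M x = act N x * T"
    if T: "T \<in> carrier_mat (mdim N) (mdim M)" and g: "\<forall>g. T * gact M g = gact N g * T" for x
  proof (induction x)
    case (Gen g)
    with g show ?case by simp
  next
    case (Scal c)
    show ?case
      using T by (simp add: mult_smult_distrib[OF T one_carrier_mat] mult_smult_assoc_mat[OF one_carrier_mat T])
  next
    case (Plus x y)
    then show ?case
      by (simp add: mult_add_distrib_mat[OF T m m] add_mult_distrib_mat[OF n n T])
  next
    case (Times x y)
    have "T * (act M x * act M y) = act N x * T * act M y"
      using assoc_mult_mat[OF T m m, of x y] Times by simp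
    also have "\<dots> = act N x * act N y * T"
      using assoc_mult_mat[OF n T m, of x y] assoc_mult_mat[OF n n T, of x y] Times by simp
    finally show ?case by simp
  qed
  moreover have "T * gact M g = gact N g * T" if "\<forall>x. T * act M x = act N x * T" for g
    using spec[OF that, of "Gen g"] by simp
  ultimately show ?thesis
    by (auto simp: uq_hom_def)
qed

lemma gact_trivial_mod: "gact trivial_mod g = eps g \<cdot>\<^sub>m 1\<^sub>m 1"
  by (auto simp: trivial_mod_def eps_def)

text \<open>A homomorphism out of the trivial module is a single column on which every generator
  acts by its counit; \<open>coords\<close> turns this into the equations for invariant
  tensors.\<close>

lemma uq_hom_trivial_word_iff:
  assumes T: "T \<in> carrier_mat (2 ^ length w) 1"
  shows "T \<in> uq_hom trivial_mod (word_mod q w) \<longleftrightarrow>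
    inv_tensor q (params q w) (coords (length w) (col T 0))"
proof -
  let ?W = "gact (word_mod q w)"
  have W: "?W g \<in> carrier_mat (2 ^ length w) (2 ^ length w)" for g
    by (rule word_mod_carrier')
  have v: "col T 0 \<in> carrier_vec (2 ^ length w)"
    using T by (auto simp: col_def)
  have "T * gact trivial_mod g = ?W g * T \<longleftrightarrow>
      uop q g (params q w) (coords (length w) (col T 0)) = (\<lambda>l. eps g * coords (length w) (col T 0) l)"
    (is "?L \<longleftrightarrow> ?R") for g
  proof -
    have "T * gact trivial_mod g = eps g \<cdot>\<^sub>m T"
      using T by (simp add: gact_trivial_mod mult_smult_distrib[OF T one_carrier_mat[of 1], simplified])
    then have "?L \<longleftrightarrow> eps g \<cdot>\<^sub>m T = ?W g * T"
      by simp
    also have "\<dots> \<longleftrightarrow> ?W g *\<^sub>v col T 0 = eps g \<cdot>\<^sub>v col T 0"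
    proof
      assume "eps g \<cdot>\<^sub>m T = ?W g * T"
      then have "col (?W g * T) 0 = col (eps g \<cdot>\<^sub>m T) 0" by simp
      moreover have "col (?W g * T) 0 = ?W g *\<^sub>v col T 0"
        by (rule col_mult2[OF W T]) simp
      moreover have "col (eps g \<cdot>\<^sub>m T) 0 = eps g \<cdot>\<^sub>v col T 0"
        using T by (intro eq_vecI) auto
      ultimately show "?W g *\<^sub>v col T 0 = eps g \<cdot>\<^sub>v col T 0" by simp
    next
      assume eq: "?W g *\<^sub>v col T 0 = eps g \<cdot>\<^sub>v col T 0"
      show "eps g \<cdot>\<^sub>m T = ?W g * T"
      proof (rule eq_matI)
        fix i j assume "i < dim_row (?W g * T)" "j < dim_col (?W g * T)"
        then have "i < 2 ^ length w" "j = 0"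
          using T W[of g] by auto
        then show "(eps g \<cdot>\<^sub>m T) $$ (i, j) = (?W g * T) $$ (i, j)"
          using arg_cong[OF eq, of "\<lambda>v. v $ i"] T W[of g] by simp
      qed (use T W[of g] in auto)
    qed
    also have "\<dots> \<longleftrightarrow> coords (length w) (?W g *\<^sub>v col T 0) = coords (length w) (eps g \<cdot>\<^sub>v col T 0)"
      using coords_inj v W[of g] by (metis mult_mat_vec_carrier smult_carrier_vec)
    also have "\<dots> \<longleftrightarrow> ?R"
      by (simp only: coords_gact[OF v] coords_smult[OF v, abs_def] fun_eq_iff)
    finally show ?thesis .
  qed
  moreover have "mdim trivial_mod = 1" by (simp add: trivial_mod_def)
  moreover have "gact trivial_mod g \<in> carrier_mat 1 1" for g by (simp add: gact_trivial_mod)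
  ultimately show ?thesis
    using T uq_hom_iff_generators[of trivial_mod "word_mod q w" T] W
    by (simp add: mdim_word_mod inv_tensor_def fun_eq_iff)
qed

lemma uq_hom_trivial_word_eq_0_iff:
  "uq_hom trivial_mod (word_mod q w) = {0\<^sub>m (2 ^ length w) 1} \<longleftrightarrow> \<not> has_inv q (params q w)"
proof -
  have "coords (length w) (col (0\<^sub>m (2 ^ length w) 1) 0) = (\<lambda>l. 0)"
    using coords_zero[of "length w"] by simp
  then have "0\<^sub>m (2 ^ length w) 1 \<in> uq_hom trivial_mod (word_mod q w)"
    by (subst uq_hom_trivial_word_iff) (auto simp: inv_tensor_def)
  moreover have "(\<exists>T \<in> uq_hom trivial_mod (word_mod q w). T \<noteq> 0\<^sub>m (2 ^ length w) 1) \<longleftrightarrow> has_inv q (params q w)"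
  proof
    assume "\<exists>T \<in> uq_hom trivial_mod (word_mod q w). T \<noteq> 0\<^sub>m (2 ^ length w) 1"
    then obtain T where T: "T \<in> uq_hom trivial_mod (word_mod q w)" "T \<noteq> 0\<^sub>m (2 ^ length w) 1"
      by blast
    then have c: "T \<in> carrier_mat (2 ^ length w) 1"
      by (simp add: uq_hom_def mdim_word_mod trivial_mod_def)
    have "coords (length w) (col T 0) \<noteq> (\<lambda>l. 0)"
    proof
      assume "coords (length w) (col T 0) = (\<lambda>l. 0)"
      then have "coords (length w) (col T 0) = coords (length w) (0\<^sub>v (2 ^ length w))"
        by (simp add: coords_zero)
      then have eq: "col T 0 = 0\<^sub>v (2 ^ length w)"
        using c by (intro coords_inj) (auto simp: col_def)
      have "T = 0\<^sub>m (2 ^ length w) 1"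
      proof (rule eq_matI)
        fix i j assume "i < dim_row (0\<^sub>m (2 ^ length w) 1 :: complex mat)"
          "j < dim_col (0\<^sub>m (2 ^ length w) 1 :: complex mat)"
        then show "T $$ (i, j) = 0\<^sub>m (2 ^ length w) 1 $$ (i, j)"
          using arg_cong[OF eq, of "\<lambda>v. v $ i"] c by simp
      qed (use c in auto)
      with T(2) show False by simp
    qed
    with T(1) c show "has_inv q (params q w)"
      by (auto simp: has_inv_def uq_hom_trivial_word_iff)
  next
    assume "has_inv q (params q w)"
    then obtain \<psi> where \<psi>: "inv_tensor q (params q w) \<psi>" "\<psi> \<noteq> (\<lambda>l. 0)"
      by (auto simp: has_inv_def)
    obtain v where v: "v \<in> carrier_vec (2 ^ length w)" "coords (length w) v = \<psi>"
      using coords_surj[of "length w" \<psi>] inv_tensor_support[OF \<psi>(1)] by auto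
    define T where "T = mat (2 ^ length w) 1 (\<lambda>(i, _). v $ i)"
    have T: "T \<in> carrier_mat (2 ^ length w) 1" "col T 0 = v"
      using v(1) by (auto simp: T_def)
    have "T \<noteq> 0\<^sub>m (2 ^ length w) 1"
      using \<psi>(2) v(2) T(2) by (auto simp: coords_zero)
    then show "\<exists>T \<in> uq_hom trivial_mod (word_mod q w). T \<noteq> 0\<^sub>m (2 ^ length w) 1"
      using uq_hom_trivial_word_iff[OF T(1), of q] T(2) v(2) \<psi>(1) by blast
  qed
  ultimately show ?thesis by blast
qed

lemma hdim_eq_0_iff: "hdim q w = 0 \<longleftrightarrow> \<not> has_inv q (params q w)"
proof -
  let ?H = "uq_hom trivial_mod (word_mod q w)" and ?S = "uq_hom_space trivial_mod (word_mod q w)"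
  let ?M = "module_mat TYPE(complex) (2 ^ length w) 1"
  have S: "?S = ?M\<lparr>carrier := ?H\<rparr>"
    by (simp add: uq_hom_space_def mdim_word_mod trivial_mod_def)
  interpret V: vectorspace class_ring ?M
    by (rule matrix_vs)
  interpret W: vectorspace class_ring ?S
    by (rule hdim_vectorspace)
  \<comment> \<open>Closure is inherited from the vector space structure of \<open>?S\<close>, which
    shares its operations with \<open>?M\<close>.\<close>
  have "VectorSpace.subspace class_ring ?H ?M"
  proof (rule VectorSpace.subspace.intro[OF V.vectorspace_axioms], rule submodule.intro)
    show "Module.module class_ring ?M" by (rule V.module_axioms)
    show "?H \<subseteq> carrier ?M"
      by (auto simp: uq_hom_def module_mat_simps mdim_word_mod trivial_mod_def)
    show "\<And>v w. v \<in> ?H \<Longrightarrow> w \<in> ?H \<Longrightarrow> v \<oplus>\<^bsub>?M\<^esub> w \<in> ?H"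
      using W.M.a_closed by (simp add: S)
    show "\<zero>\<^bsub>?M\<^esub> \<in> ?H"
      using W.M.zero_closed by (simp add: S)
    show "\<And>c v. c \<in> carrier class_ring \<Longrightarrow> v \<in> ?H \<Longrightarrow> c \<odot>\<^bsub>?M\<^esub> v \<in> ?H"
      using W.smult_closed by (simp add: S)
  qed
  then have "W.fin_dim"
    using V.fin_dim_subspace[OF _ fin_dim_module_mat_1] unfolding S by simp
  from W.dim_eq_0_iff[OF this] have "hdim q w = 0 \<longleftrightarrow> ?H = {0\<^sub>m (2 ^ length w) 1}"
    by (simp add: hdim_def S module_mat_simps)
  then show ?thesis
    by (simp only: uq_hom_trivial_word_eq_0_iff)
qed

section \<open>Arc configurations\<close>

abbreviation ends :: "nat \<times> nat \<Rightarrow> nat set" where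
  "ends \<equiv> \<lambda>(i, j). {i, j}"

text \<open>Counting ends: each arc has two different ends, and ends of different arcs are
  disjoint.\<close>

lemma Conf_iff:
  "C \<in> Conf w \<longleftrightarrow> C \<subseteq> arcs w \<and> disjoint_family_on ends C \<and> (\<Union>p\<in>C. ends p) = {..<length w}"
proof -
  have "2 * card C = length w"
    if C: "C \<subseteq> arcs w" "disjoint_family_on ends C" "(\<Union>p\<in>C. ends p) = {..<length w}"
  proof -
    have "arcs w \<subseteq> {..<length w} \<times> {..<length w}"
      by (auto simp: arcs_def)
    with C(1) have "finite C"
      by (meson finite_SigmaI finite_lessThan finite_subset)
    then have "card (\<Union>p\<in>C. ends p) = (\<Sum>p\<in>C. card (ends p))"
      using disjoint_family_onD[OF C(2)] by (intro card_UN_disjoint) (simp_all add: case_prod_beta)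
    also have "\<dots> = (\<Sum>p\<in>C. 2)"
      using C(1) by (intro sum.cong) (auto simp: arcs_def)
    finally show ?thesis
      using C(3) by simp
  qed
  then show ?thesis
    unfolding Conf_def mem_Collect_eq by metis
qed

text \<open>Shared by the swap, insertion and removal below, which all relabel positions
  injectively. Whether arcs go to arcs depends on the words and is checked there.\<close>

lemma arcs_transport:
  assumes C: "disjoint_family_on ends C" "(\<Union>p\<in>C. ends p) = S" and f: "inj_on f S"
  shows "disjoint_family_on ends (map_prod f f ` C)" "(\<Union>p\<in>map_prod f f ` C. ends p) = f ` S"
proof -
  have e: "ends (map_prod f f p) = f ` ends p" for p
    by (cases p) auto
  have sub: "ends p \<subseteq> S" if "p \<in> C" for p
    unfolding C(2)[symmetric] using that by (rule UN_upper)
  show "disjoint_family_on ends (map_prod f f ` C)"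
    unfolding disjoint_family_on_def
  proof (intro ballI impI)
    fix p p' assume "p \<in> map_prod f f ` C" "p' \<in> map_prod f f ` C" and ne: "p \<noteq> p'"
    then obtain r r' where r: "r \<in> C" "r' \<in> C" "p = map_prod f f r" "p' = map_prod f f r'"
      by (elim imageE)
    with ne have "ends r \<inter> ends r' = {}"
      by (intro disjoint_family_onD[OF C(1)]) auto
    then show "ends p \<inter> ends p' = {}"
      unfolding r(3,4) e using inj_on_image_Int[OF f sub[OF r(1)] sub[OF r(2)]] by simp
  qed
  have "(\<Union>p\<in>map_prod f f ` C. ends p) = (\<Union>p\<in>C. f ` ends p)"
    by (simp only: image_image e)
  also have "\<dots> = f ` S"
    unfolding C(2)[symmetric] by (simp only: image_UN)
  finally show "(\<Union>p\<in>map_prod f f ` C. ends p) = f ` S" .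
qed

lemma Conf_Nil: "Conf [] = {{}}"
  by (auto simp: Conf_iff arcs_def disjoint_family_on_def)

text \<open>The transposition reverses the order of no pair of positions except the exchanged one,
  and \<open>a \<noteq> b + 2\<close> says that this pair is not an arc.\<close>

lemma Conf_swap:
  assumes "Conf (us @ b # a # vs) \<noteq> {}" "a \<noteq> b + 2"
  shows "Conf (us @ a # b # vs) \<noteq> {}"
proof -
  let ?w = "us @ b # a # vs" and ?w' = "us @ a # b # vs" and ?k = "length us"
  define f where "f = transpose ?k (Suc ?k)"
  obtain C where C: "C \<subseteq> arcs ?w" "disjoint_family_on ends C" "(\<Union>p\<in>C. ends p) = {..<length ?w}"
    using assms(1) by (auto simp: Conf_iff)
  have nth: "?w' ! f i = ?w ! i" for i
    by (auto simp: f_def transpose_def nth_append nth_Cons' Suc_diff_le)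
  have "(f i, f j) \<in> arcs ?w'" if "(i, j) \<in> arcs ?w" for i j
  proof -
    from that have ij: "i < j" "j < length ?w" "?w ! j = ?w ! i + 2"
      by (auto simp: arcs_def)
    then have "\<not> (i = ?k \<and> j = Suc ?k)"
      using assms(2) by (auto simp: nth_append)
    with ij(1,2) have "f i < f j" "f j < length ?w'"
      by (auto simp: f_def transpose_def)
    with ij(3) show ?thesis
      by (simp add: arcs_def nth)
  qed
  then have "map_prod f f ` C \<subseteq> arcs ?w'"
    using C(1) by auto
  moreover have "f ` {..<length ?w} = {..<length ?w'}"
    unfolding f_def by (subst transpose_image_eq) auto
  moreover have "inj_on f {..<length ?w}"
    by (simp add: f_def)
  ultimately have "map_prod f f ` C \<in> Conf ?w'"
    using arcs_transport[OF C(2,3)] by (auto simp: Conf_iff)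
  then show ?thesis by blast
qed

lemma Conf_insert:
  assumes "Conf (us @ vs) \<noteq> {}"
  shows "Conf (us @ a # (a + 2) # vs) \<noteq> {}"
proof -
  let ?w = "us @ vs" and ?w' = "us @ a # (a + 2) # vs" and ?k = "length us"
  \<comment> \<open>Old positions are moved apart to leave a gap for the two ends of the new
    arc.\<close>
  define f where "f i = (if i < ?k then i else i + 2)" for i
  obtain C where C: "C \<subseteq> arcs ?w" "disjoint_family_on ends C" "(\<Union>p\<in>C. ends p) = {..<length ?w}"
    using assms by (auto simp: Conf_iff)
  have nth: "?w' ! f i = ?w ! i" for i
    by (auto simp: f_def nth_append)
  have "(f i, f j) \<in> arcs ?w'" if "(i, j) \<in> arcs ?w" for i j
    using that nth by (auto simp: arcs_def f_def)
  then have "map_prod f f ` C \<subseteq> arcs ?w'"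
    using C(1) by auto
  moreover have inj: "inj_on f {..<length ?w}"
    by (auto simp: f_def inj_on_def)
  moreover have im: "f ` {..<length ?w} = {..<length ?w'} - {?k, Suc ?k}"
  proof (intro equalityI subsetI)
    fix j assume "j \<in> {..<length ?w'} - {?k, Suc ?k}"
    then have "j = f (if j < ?k then j else j - 2)" "(if j < ?k then j else j - 2) < length ?w"
      by (auto simp: f_def)
    then show "j \<in> f ` {..<length ?w}" by blast
  qed (auto simp: f_def split: if_splits)
  moreover have "(?k, Suc ?k) \<in> arcs ?w'"
    by (auto simp: arcs_def nth_append)
  moreover note T = arcs_transport[OF C(2,3) inj]
  have "disjoint_family_on ends (insert (?k, Suc ?k) (map_prod f f ` C))"
  proof -
    have "ends p \<inter> {?k, Suc ?k} = {}" if "p \<in> map_prod f f ` C" for p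
      using T(2) im that by blast
    then show ?thesis
      using T(1) unfolding disjoint_family_on_def by auto
  qed
  moreover have "(\<Union>p\<in>insert (?k, Suc ?k) (map_prod f f ` C). ends p) = {..<length ?w'}"
    unfolding UN_insert T(2) im by auto
  ultimately have "insert (?k, Suc ?k) (map_prod f f ` C) \<in> Conf ?w'"
    by (auto simp: Conf_iff)
  then show ?thesis by blast
qed

lemma Conf_remove:
  assumes "Conf w \<noteq> {}" "w \<noteq> []"
  obtains us a vs ws where "w = us @ a # vs @ (a + 2) # ws" "Conf (us @ vs @ ws) \<noteq> {}"
proof -
  obtain C where C: "C \<subseteq> arcs w" "disjoint_family_on ends C" "(\<Union>p\<in>C. ends p) = {..<length w}"
    using assms(1) by (auto simp: Conf_iff)
  then have "C \<noteq> {}"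
    using assms(2) by auto
  then obtain i j where p: "(i, j) \<in> C" by auto
  with C(1) have ij: "i < j" "j < length w" "w ! j = w ! i + 2"
    by (auto simp: arcs_def)
  define us vs ws where "us = take i w" and "vs = take (j - Suc i) (drop (Suc i) w)"
    and "ws = drop (Suc j) w"
  have "drop (Suc i) w = vs @ drop (j - Suc i) (drop (Suc i) w)"
    by (simp only: vs_def append_take_drop_id)
  also have "drop (j - Suc i) (drop (Suc i) w) = w ! j # ws"
    using ij(1,2) by (simp add: ws_def Cons_nth_drop_Suc)
  finally have "drop (Suc i) w = vs @ (w ! i + 2) # ws"
    using ij(3) by simp
  moreover have "w = us @ w ! i # drop (Suc i) w"
    unfolding us_def using ij by (intro id_take_nth_drop) simp
  ultimately have w: "w = us @ w ! i # vs @ (w ! i + 2) # ws"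
    by simp
  have len: "length us = i" "length vs = j - Suc i" "length ws = length w - Suc j"
    using ij by (auto simp: us_def vs_def ws_def)
  let ?w' = "us @ vs @ ws" and ?S = "{..<length w} - {i, j}" and ?C = "C - {(i, j)}"
  \<comment> \<open>Closes the gaps left by the deleted ends: one place is lost after
    \<open>i\<close>, two after \<open>j\<close>.\<close>
  define f where "f k = (if k < i then k else if k < j then k - 1 else k - 2)" for k
  have nth: "?w' ! f k = w ! k" if k: "k \<in> ?S" for k
  proof -
    have "w ! k = (us @ w ! i # vs @ (w ! i + 2) # ws) ! k"
      using arg_cong[OF w, of "\<lambda>w. w ! k"] .
    also have "\<dots> = ?w' ! f k"
    proof -
      consider "k < i" | "i < k" "k < j" | "j < k" "k < length w"
        using k by force
      then show ?thesis
      proof cases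
        case 1
        then show ?thesis by (simp add: f_def nth_append len)
      next
        case 2
        then obtain d where d: "k = Suc (i + d)"
          using less_imp_Suc_add by blast
        with 2 have "d < j - Suc i" by simp
        with 2 d show ?thesis by (simp add: f_def nth_append len)
      next
        case 3
        then obtain d where "k = Suc (j + d)"
          using less_imp_Suc_add by blast
        moreover obtain e where "j = Suc (i + e)"
          using ij(1) less_imp_Suc_add by blast
        ultimately show ?thesis by (simp add: f_def nth_append nth_Cons' len)
      qed
    qed
    finally show ?thesis by simp
  qed
  have disj: "disjoint_family_on ends ?C"
    using C(2) by (auto simp: disjoint_family_on_def)
  have un: "(\<Union>p\<in>?C. ends p) = ?S"
  proof -
    have "ends p' \<inter> {i, j} = {}" if "p' \<in> ?C" for p'
      using disjoint_family_onD[OF C(2), of p' "(i, j)"] that p by auto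
    then have "(\<Union>p\<in>?C. ends p) = (\<Union>p\<in>C. ends p) - {i, j}"
      by auto
    then show ?thesis using C(3) by simp
  qed
  have inj: "inj_on f ?S"
    using ij by (auto simp: f_def inj_on_def)
  have sub: "f ` ?S \<subseteq> {..<length ?w'}"
    using ij by (auto simp: f_def len)
  \<comment> \<open>Surjectivity comes from counting, without an explicit inverse.\<close>
  have "card (f ` ?S) = length ?w'"
    using card_image[OF inj] ij len by (simp add: card_Diff_subset)
  with sub have im: "f ` ?S = {..<length ?w'}"
    by (intro card_subset_eq) auto
  have "(f k, f l) \<in> arcs ?w'" if "(k, l) \<in> ?C" for k l
  proof -
    have kl: "k \<in> ?S" "l \<in> ?S"
      using un that by (auto simp: set_eq_iff)
    from that C(1) have "k < l" "w ! l = w ! k + 2"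
      by (auto simp: arcs_def)
    moreover from \<open>k < l\<close> kl ij(1) have "f k < f l"
      by (auto simp: f_def)
    moreover have "f l < length ?w'"
      using im kl by blast
    ultimately show ?thesis
      using nth[OF kl(1)] nth[OF kl(2)] by (simp add: arcs_def)
  qed
  then have "map_prod f f ` ?C \<subseteq> arcs ?w'" by auto
  with arcs_transport[OF disj un inj] have "map_prod f f ` ?C \<in> Conf ?w'"
    unfolding Conf_iff im by blast
  then show ?thesis
    using that[OF w] by blast
qed

section \<open>Invariants and configurations\<close>

locale not_root_of_unity =
  fixes q :: complex
  assumes q_nonzero: "q \<noteq> 0" and not_root: "\<And>m. m > 0 \<Longrightarrow> q ^ m \<noteq> 1"
begin

text \<open>Here q being no root of unity turns the genericity conditions on parameters into
  conditions on integer letters.\<close>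

lemma powi_eq_iff: "q powi a = q powi b \<longleftrightarrow> a = b"
proof -
  have less: "q powi a \<noteq> q powi b" if "a < b" for a b
  proof
    assume "q powi a = q powi b"
    then have "q powi (b - a) = 1"
      using q_nonzero by (simp add: power_int_diff)
    then have "q ^ nat (b - a) = 1"
      using that by (simp add: power_int_def)
    then show False
      using not_root[of "nat (b - a)"] that by simp
  qed
  show ?thesis
    using less[of a b] less[of b a] by (cases a b rule: linorder_cases) auto
qed

lemma sq_mult_powi: "q\<^sup>2 * q powi a = q powi (a + 2)"
  using q_nonzero by (simp add: power_int_add power2_eq_square)

lemma sq_neq_1: "q\<^sup>2 \<noteq> 1"
  using not_root[of 2] by simp

lemma has_inv_swap_word:
  assumes "a \<noteq> b + 2" "has_inv q (params q (us @ a # b # vs))"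
  shows "has_inv q (params q (us @ b # a # vs)) \<or> b = a + 2 \<and> has_inv q (params q (us @ vs))"
  using has_inv_swap[of q "q powi a" "q powi b" "params q us" "params q vs"] assms
    q_nonzero sq_neq_1 by (simp add: sq_mult_powi powi_eq_iff)

text \<open>
  The letter $a + 4$ obtained by rotation differs by at least 4 from all letters of \<open>w\<close>, so it can be
  moved back to the front. Iterating this gives invariants for infinitely many first letters, but
  each first parameter $z$ makes $1 / (z q^2)$ an eigenvalue of $f_1 f_0$ on \<open>w\<close>.
\<close>

lemma not_has_inv_Cons_max:
  assumes le: "\<And>b. b \<in> set w \<Longrightarrow> b \<le> a"
  shows "\<not> has_inv q (params q (a # w))"
proof
  assume "has_inv q (params q (a # w))"
  have step: "has_inv q (params q ((a' + 4) # w))" if "has_inv q (params q (a' # w))" "a \<le> a'" for a'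
  proof -
    have move: "has_inv q (params q ((a' + 4) # us @ vs))"
      if "has_inv q (params q (us @ (a' + 4) # vs))" "set us \<subseteq> set w" for us vs
      using that
    proof (induction us arbitrary: vs rule: rev_induct)
      case (snoc b us)
      then have "b \<le> a'"
        using le \<open>a \<le> a'\<close> by fastforce
      then have "has_inv q (params q (us @ (a' + 4) # b # vs))"
        using has_inv_swap_word[of b "a' + 4" us vs] snoc.prems(1) by auto
      then show ?case
        using snoc.IH[of "b # vs"] snoc.prems(2) by simp
    qed simp
    have "q powi a' * q ^ 4 = q powi (a' + 4)"
      using q_nonzero by (simp add: power_int_add)
    then have "has_inv q (params q (w @ [a' + 4]))"
      using has_inv_rotate[of q "q powi a'" "params q w"] q_nonzero that(1) by simp
    then show ?thesis
      using move[of w "[]"] by simp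
  qed
  have "has_inv q (params q ((a + 4 * int k) # w))" for k
  proof (induction k)
    case 0
    with \<open>has_inv q (params q (a # w))\<close> show ?case by simp
  next
    case (Suc k)
    from step[OF this] show ?case by (simp add: algebra_simps)
  qed
  then have "range (\<lambda>k. q powi (a + 4 * int k)) \<subseteq> {z. z \<noteq> 0 \<and> has_inv q (z # params q w)}"
    using q_nonzero by auto
  then have "finite (range (\<lambda>k. q powi (a + 4 * int k)))"
    using finite_has_inv_Cons[OF q_nonzero] by (rule finite_subset)
  moreover have "inj (\<lambda>k. q powi (a + 4 * int k))"
    by (auto simp: inj_def powi_eq_iff)
  ultimately show False
    by (simp add: finite_image_iff)
qed

lemma has_inv_imp_Conf:
  assumes "has_inv q (params q w)"
  shows "Conf w \<noteq> {}"
  using assms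
proof (induction w rule: length_induct)
  case (1 w)
  show ?case
  proof (cases "w = []")
    case False
    define M where "M = Max (set w)"
    \<comment> \<open>Inner induction on the number of letters before \<open>M\<close>. The length
      stays equal to that of \<open>w\<close>, so the outer induction hypothesis applies once two
      letters are deleted.\<close>
    have "Conf (us @ M # vs) \<noteq> {}"
      if "has_inv q (params q (us @ M # vs))" "length (us @ M # vs) = length w"
        "\<And>b. b \<in> set (us @ vs) \<Longrightarrow> b \<le> M" for us vs
      using that
    proof (induction us arbitrary: vs rule: rev_induct)
      case Nil
      then show ?case
        using not_has_inv_Cons_max[of vs M] by simp
    next
      case (snoc a us)
      have "a \<le> M" using snoc.prems(3) by simp
      then consider "has_inv q (params q (us @ M # a # vs))"
        | "M = a + 2" "has_inv q (params q (us @ vs))"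
        using has_inv_swap_word[of a M us vs] snoc.prems(1) by auto
      then show ?case
      proof cases
        case 1
        then have "Conf (us @ M # a # vs) \<noteq> {}"
          using snoc.prems(2,3) by (intro snoc.IH) auto
        then show ?thesis
          using Conf_swap[of us M a vs] \<open>a \<le> M\<close> by simp
      next
        case 2
        then have "Conf (us @ vs) \<noteq> {}"
          using "1.IH" snoc.prems(2) by simp
        then show ?thesis
          using Conf_insert[of us vs a] 2(1) by simp
      qed
    qed
    moreover have "M \<in> set w" "\<And>b. b \<in> set w \<Longrightarrow> b \<le> M"
      using False by (auto simp: M_def)
    moreover from this(1) obtain us vs where "w = us @ M # vs"
      by (auto dest: split_list)
    ultimately show ?thesis
      using "1.prems" by auto
  qed (simp add: Conf_Nil)
qed

lemma Conf_imp_has_inv: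
  assumes "Conf w \<noteq> {}"
  shows "has_inv q (params q w)"
  using assms
proof (induction w rule: length_induct)
  case (1 w)
  show ?case
  proof (cases "w = []")
    case True
    \<comment> \<open>The empty product is the trivial module, spanned by an invariant
      vector.\<close>
    have "inv_tensor q [] (\<lambda>l. if l = [] then 1 else 0)"
      by (simp add: inv_tensor_def)
    moreover have "(\<lambda>l. if l = [] then 1 else 0) \<noteq> ((\<lambda>l. 0) :: tensor)"
      by (auto simp: fun_eq_iff)
    ultimately show ?thesis
      using True by (auto simp: has_inv_def)
  next
    case False
    obtain us a vs ws where w: "w = us @ a # vs @ (a + 2) # ws" "Conf (us @ vs @ ws) \<noteq> {}"
      by (rule Conf_remove[OF "1.prems" False])
    then have "has_inv q (params q us @ params q vs @ params q ws)"
      using "1.IH"[rule_format, of "us @ vs @ ws"] by simp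
    then have "has_inv q (params q us @ q powi a # params q vs @ (q\<^sup>2 * q powi a) # params q ws)"
      using q_nonzero sq_neq_1 by (intro has_inv_insert) auto
    then show ?thesis
      by (simp add: w(1) sq_mult_powi)
  qed
qed

end

theorem theorem5p25:
  fixes q :: complex and n :: nat and w :: "int list"
  assumes "q \<noteq> 0"
    and "\<forall>m>0. q ^ m \<noteq> 1"
    and "length w = 2 * n"
    and "\<forall>a\<in>set w. even a"
  shows "hdim q w = 0 \<longleftrightarrow> Conf w = {}"
proof -
  interpret not_root_of_unity q
    using assms(1,2) by unfold_locales auto
  show ?thesis
    using hdim_eq_0_iff has_inv_imp_Conf Conf_imp_has_inv by blast
qed

end
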